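(* Let $g,f,w$ be generalized density functions on $\mathbb{R}^d$ with $g\ast f=w$, and let the known characteristic function $\phi=Ft(f)$ be such that $\phi^{-1}$ satisfies: there is a vector $m=(m_1,\dots,m_d)$ of non-negative integers with $\int\prod_{i=1}^d(1+t_i^2)^{-m_i}|\phi^{-1}(t)|\,dt<\infty$. Let $\{z_j\}_{j=1}^n$ be a random sample from the distribution with generalized density $w$. Then the deconvolution estimator $$\hat g_n=Ft^{-1}(\phi^{-1}\hat\varepsilon_n),\qquad \hat\varepsilon_n(s)=\frac1n\sum_{j=1}^ne^{is^Tz_j},$$ is consistent in $S^{*}$: for any finite set $\psi_1,\dots,\psi_v\in S$, $$\big((\hat g_n-g,\psi_1),\dots,(\hat g_n-g,\psi_v)\big)^T\to_p0 .$$
   Context: $S$ is the Schwartz space on $\mathbb{R}^d$ and $S^{*}$ its dual (tempered distributions). $Ft$ is the Fourier transform on $S^{*}$, normalized so that $Ft(b)(s)=\int b(x)e^{ix^Ts}dx$ for integrable $b$. The generalized density of a probability distribution on $\mathbb{R}^d$ is the generalized derivative $\frac{\partial^d}{\partial x_1\cdots\partial x_d}F$ of its distribution function $F$, an element of $S^{*}$; its Fourier transform is the characteristic function of the distribution. The convolution of two generalized densities is the generalized density of the sum of independent variables with those distributions. $\to_p$ denotes convergence in probability. *)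

theory Defs
  imports "HOL-Probability.Probability"
begin

section \<open>The Schwartz space and tempered distributions on \<open>R\<^sup>d\<close>\<close>

text \<open>\<open>R\<^sup>d\<close> is \<open>real ^ 'd\<close>; test functions and functionals are complex valued.\<close>

type_synonym 'd test_fun = "real ^ 'd \<Rightarrow> complex"
type_synonym 'd functional = "'d test_fun \<Rightarrow> complex"

definition partial :: "'d::finite \<Rightarrow> 'd test_fun \<Rightarrow> 'd test_fun" where
  "partial i \<psi> x = frechet_derivative \<psi> (at x) (axis i 1)"

definition partials :: "'d::finite list \<Rightarrow> 'd test_fun \<Rightarrow> 'd test_fun" where
  "partials is \<psi> = foldr partial is \<psi>"

definition monomial :: "('d::finite \<Rightarrow> nat) \<Rightarrow> real ^ 'd \<Rightarrow> real" where
  "monomial \<alpha> x = (\<Prod>i\<in>UNIV. (x $ i) ^ \<alpha> i)"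

text \<open>If all iterated partial derivatives are differentiable everywhere, they are all continuous,
  so the first conjunct below says that \<open>\<psi>\<close> is infinitely differentiable.\<close>

definition Schwartz :: "'d::finite test_fun set" where
  "Schwartz = {\<psi>. (\<forall>is x. partials is \<psi> differentiable (at x)) \<and>
     (\<forall>\<alpha> is. bounded (range (\<lambda>x. monomial \<alpha> x *\<^sub>R partials is \<psi> x)))}"

definition Schwartz_tendsto :: "(nat \<Rightarrow> 'd::finite test_fun) \<Rightarrow> 'd test_fun \<Rightarrow> bool" where
  "Schwartz_tendsto \<Psi> \<psi> \<longleftrightarrow> (\<forall>\<alpha> is. uniform_limit UNIV
     (\<lambda>k x. monomial \<alpha> x *\<^sub>R partials is (\<Psi> k) x)
     (\<lambda>x. monomial \<alpha> x *\<^sub>R partials is \<psi> x) sequentially)"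

text \<open>The dual \<open>S\<^sup>*\<close>. Since the topology of \<open>S\<close> is metrizable, continuity is sequential
  continuity. A functional is a total function on all of \<open>'d test_fun\<close>, but only its values
  on \<^const>\<open>Schwartz\<close> matter, so equality in \<open>S\<^sup>*\<close> is \<open>dist_eq\<close>.\<close>

definition tempered :: "'d::finite functional set" where
  "tempered = {T.
     (\<forall>\<psi>\<in>Schwartz. \<forall>\<eta>\<in>Schwartz. T (\<lambda>x. \<psi> x + \<eta> x) = T \<psi> + T \<eta>) \<and>
     (\<forall>c. \<forall>\<psi>\<in>Schwartz. T (\<lambda>x. c * \<psi> x) = c * T \<psi>) \<and>
     (\<forall>\<Psi>. \<forall>\<psi>\<in>Schwartz. (\<forall>k. \<Psi> k \<in> Schwartz) \<longrightarrow> Schwartz_tendsto \<Psi> \<psi> \<longrightarrow>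
        (\<lambda>k. T (\<Psi> k)) \<longlonglongrightarrow> T \<psi>)}"

definition dist_eq :: "'d::finite functional \<Rightarrow> 'd functional \<Rightarrow> bool" where
  "dist_eq T U \<longleftrightarrow> (\<forall>\<psi>\<in>Schwartz. T \<psi> = U \<psi>)"

text \<open>The functional \<open>\<psi> \<mapsto> \<integral> b(x) \<psi>(x) dx\<close> given by an ordinary function. Bochner integrals
  of non-integrable functions are \<open>0\<close>, hence the explicit integrability in
  \<open>represented_by\<close>, which is the identification of \<open>b\<close> with an element of \<open>S\<^sup>*\<close>.\<close>

definition regular :: "(real ^ 'd::finite \<Rightarrow> complex) \<Rightarrow> 'd functional" where
  "regular b \<psi> = (LINT x|lborel. b x * \<psi> x)"

definition represented_by :: "'d::finite functional \<Rightarrow> (real ^ 'd \<Rightarrow> complex) \<Rightarrow> bool" where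
  "represented_by T b \<longleftrightarrow> b \<in> borel_measurable lborel \<and>
     (\<forall>\<psi>\<in>Schwartz. integrable lborel (\<lambda>x. b x * \<psi> x)) \<and> dist_eq T (regular b)"


section \<open>Fourier transform\<close>

definition fourier :: "'d::finite test_fun \<Rightarrow> 'd test_fun" where
  "fourier \<psi> s = (LINT x|lborel. \<psi> x * iexp (x \<bullet> s))"

definition inv_fourier :: "'d::finite test_fun \<Rightarrow> 'd test_fun" where
  "inv_fourier \<psi> x =
     (LINT s|lborel. \<psi> s * iexp (- (x \<bullet> s))) / complex_of_real ((2 * pi) ^ CARD('d))"

definition Ft :: "'d::finite functional \<Rightarrow> 'd functional" where
  "Ft T \<psi> = T (fourier \<psi>)"

definition Ft_inv :: "'d::finite functional \<Rightarrow> 'd functional" where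
  "Ft_inv T \<psi> = T (inv_fourier \<psi>)"


section \<open>Generalized densities\<close>

definition gen_deriv :: "'d::finite \<Rightarrow> 'd functional \<Rightarrow> 'd functional" where
  "gen_deriv i T \<psi> = - T (partial i \<psi>)"

definition distribution_function :: "(real ^ 'd::finite) measure \<Rightarrow> real ^ 'd \<Rightarrow> real" where
  "distribution_function \<mu> x = measure \<mu> {y. \<forall>i. y $ i \<le> x $ i}"

text \<open>An enumeration of the coordinates; partial derivatives commute on \<^const>\<open>Schwartz\<close>,
  so its order is irrelevant.\<close>

definition coordinates :: "'d::finite list" where
  "coordinates = (SOME is. distinct is \<and> set is = UNIV)"

definition gen_density :: "(real ^ 'd::finite) measure \<Rightarrow> 'd functional" where
  "gen_density \<mu> =
     foldr gen_deriv coordinates (regular (\<lambda>x. complex_of_real (distribution_function \<mu> x)))"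

definition has_gen_density :: "(real ^ 'd::finite) measure \<Rightarrow> 'd functional \<Rightarrow> bool" where
  "has_gen_density \<mu> g \<longleftrightarrow> prob_space \<mu> \<and> sets \<mu> = sets borel \<and>
     g \<in> tempered \<and> dist_eq g (gen_density \<mu>)"

definition generalized_density :: "'d::finite functional \<Rightarrow> bool" where
  "generalized_density g \<longleftrightarrow> (\<exists>\<mu>. has_gen_density \<mu> g)"

text \<open>\<open>g * f = w\<close>; \<open>G \<star> F\<close> is the distribution of the sum of independent variables with
  distributions \<open>G\<close> and \<open>F\<close>.\<close>

definition gen_convolution_eq ::
    "'d::finite functional \<Rightarrow> 'd functional \<Rightarrow> 'd functional \<Rightarrow> bool" where
  "gen_convolution_eq g f w \<longleftrightarrow>
     (\<exists>G F. has_gen_density G g \<and> has_gen_density F f \<and> has_gen_density (G \<star> F) w)"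


section \<open>The deconvolution estimator\<close>

definition empirical_char :: "(nat \<Rightarrow> 'a \<Rightarrow> real ^ 'd::finite) \<Rightarrow> nat \<Rightarrow> 'a \<Rightarrow> real ^ 'd \<Rightarrow> complex"
  where "empirical_char Z n \<omega> s = (\<Sum>j=1..n. iexp (s \<bullet> Z j \<omega>)) / of_nat n"

text \<open>\<open>\<phi>\<close> is only determined up to null sets when it represents \<open>Ft f\<close>, and so is the estimator.
  As \<open>inverse 0 = 0\<close>, the existence of \<open>1 / \<phi>\<close> has to be stated separately as \<open>\<phi> \<noteq> 0\<close>
  almost everywhere.\<close>

definition deconv_estimator ::
    "(real ^ 'd::finite \<Rightarrow> complex) \<Rightarrow> (nat \<Rightarrow> 'a \<Rightarrow> real ^ 'd) \<Rightarrow> nat \<Rightarrow> 'a \<Rightarrow> 'd functional" where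
  "deconv_estimator \<phi> Z n \<omega> =
     Ft_inv (regular (\<lambda>s. inverse (\<phi> s) * empirical_char Z n \<omega> s))"

text \<open>Measurability is required explicitly: \<^const>\<open>measure\<close> is \<open>0\<close> on non-measurable sets.\<close>

definition tendsto_in_prob ::
    "'a measure \<Rightarrow> (nat \<Rightarrow> 'a \<Rightarrow> 'b::euclidean_space) \<Rightarrow> ('a \<Rightarrow> 'b) \<Rightarrow> bool" where
  "tendsto_in_prob M X Y \<longleftrightarrow>
     (\<forall>n. X n \<in> borel_measurable M) \<and> Y \<in> borel_measurable M \<and>
     (\<forall>\<epsilon>>0. (\<lambda>n. measure M {\<omega> \<in> space M. dist (X n \<omega>) (Y \<omega>) > \<epsilon>}) \<longlonglongrightarrow> 0)"

end

(*
  The estimator is (ghat_n, psi) = 1/n sum_j h(Z_j) with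
  h(z) = int phi^{-1}(s) exp(i s.z) (Ft^{-1} psi)(s) ds.  The growth condition on phi^{-1} is
  compensated by the decay of Ft^{-1} psi, because multiplying Ft^{-1} psi by 1 + s_j^2 amounts
  to applying 1 - d_j^2 to psi; so h is bounded and the weak law of large numbers (here: from
  Hoeffding's inequality) applies.  The mean of h is
  int phi^{-1} cf_w (Ft^{-1} psi) = int cf_g (Ft^{-1} psi) = int psi dG = (g, psi).

  A generalized density is paired with psi by integrating psi against the distribution.  That phi
  and cf_w are the expected characteristic functions is known only in S*, hence needs that a
  function annihilated by all exp(-|x|^2/2 - i t.x) vanishes almost everywhere.  Fourier inversion
  on S and this uniqueness statement both come from one Gaussian smoothing identity.
*)
theory Submission
  imports Defs
begin

section \<open>Schwartz functions\<close>

text \<open>\<open>Ft f\<close> evaluates \<open>f\<close> at \<open>fourier \<psi>\<close>, and the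
  values of \<open>f\<close> are known on \<open>Schwartz\<close> only, so evaluating it requires
  that \<open>fourier \<psi>\<close> lie in \<open>Schwartz\<close> too. This dictates Gaussian test
  functions: their transforms are explicit shifted Gaussians, and both families fit into one class
  \<open>gexp\<close> whose membership in \<open>Schwartz\<close> is checked once. The Gaussian
  factor also makes bounded functions integrable, such as characteristic functions. The law of an
  observation and \<open>G \<star> F\<close> are linked only by having the same generalized density
  \<open>w\<close>. Identities between characteristic functions are therefore obtained almost
  everywhere, which suffices because they are used under integrals over the frequency. Inversion and
  uniqueness can share one identity because it asks only for integrability. Inversion then adds
  continuity and decay of \<open>\<psi>\<close>; uniqueness has to cope with a function that is
  merely integrable. The decay estimate carries constants that depend on \<open>m\<close> alone:
  membership of the estimator in \<open>tempered\<close> includes continuity, for which a bound for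
  each single \<open>\<psi>\<close> would be too weak.\<close>

lemma partial_eqI: "(f has_derivative f') (at x) \<Longrightarrow> partial i f x = f' (axis i 1)"
  unfolding partial_def using frechet_derivative_at by metis

lemma partials_Nil [simp]: "partials [] \<psi> = \<psi>"
  and partials_Cons: "partials (i # is) \<psi> = partial i (partials is \<psi>)"
  and partials_append: "partials (is @ js) \<psi> = partials is (partials js \<psi>)"
  by (simp_all add: partials_def)

lemma Schwartz_differentiable: "\<psi> \<in> Schwartz \<Longrightarrow> partials is \<psi> differentiable (at x)"
  by (simp add: Schwartz_def)

lemma Schwartz_bounded: "\<psi> \<in> Schwartz \<Longrightarrow> bounded (range (\<lambda>x. monomial \<alpha> x *\<^sub>R partials is \<psi> x))"
  by (simp add: Schwartz_def)

lemma partials_Schwartz: "\<psi> \<in> Schwartz \<Longrightarrow> partials is \<psi> \<in> Schwartz"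
  by (simp add: Schwartz_def partials_append[symmetric])

lemma partial_Schwartz: "\<psi> \<in> Schwartz \<Longrightarrow> partial i \<psi> \<in> Schwartz"
  using partials_Schwartz[of \<psi> "[i]"] by (simp add: partials_Cons)

text \<open>The restriction to \<open>Schwartz\<close> supplies differentiability at every stage of
  the iteration; \<open>frechet_derivative\<close> is an arbitrary choice where no derivative
  exists.\<close>

lemma partials_lincomb:
  assumes "\<psi> \<in> Schwartz" "\<eta> \<in> Schwartz"
  shows "partials is (\<lambda>x. a * \<psi> x + b * \<eta> x) = (\<lambda>x. a * partials is \<psi> x + b * partials is \<eta> x)"
proof (induction "is")
  case (Cons i js)
  show ?case
  proof
    fix x
    have "((\<lambda>x. a * partials js \<psi> x + b * partials js \<eta> x) has_derivative
      (\<lambda>h. a * frechet_derivative (partials js \<psi>) (at x) h + b * frechet_derivative (partials js \<eta>) (at x) h)) (at x)"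
      using Schwartz_differentiable[OF assms(1), of js x] Schwartz_differentiable[OF assms(2), of js x]
      by (auto simp: frechet_derivative_works intro!: derivative_eq_intros)
    from partial_eqI[OF this, of i]
    show "partials (i # js) (\<lambda>x. a * \<psi> x + b * \<eta> x) x = a * partials (i # js) \<psi> x + b * partials (i # js) \<eta> x"
      by (simp add: partials_Cons Cons.IH) (simp add: partial_def)
  qed
qed simp

lemma Schwartz_lincomb:
  assumes "\<psi> \<in> Schwartz" "\<eta> \<in> Schwartz"
  shows "(\<lambda>x. a * \<psi> x + b * \<eta> x) \<in> Schwartz"
proof -
  have d: "partials js (\<lambda>x. a * \<psi> x + b * \<eta> x) differentiable (at x)" for js x
    unfolding partials_lincomb[OF assms]
    by (intro derivative_intros Schwartz_differentiable assms)
  have b: "bounded (range (\<lambda>x. monomial \<alpha> x *\<^sub>R partials js (\<lambda>x. a * \<psi> x + b * \<eta> x) x))" for js \<alpha>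
  proof -
    obtain A where A: "\<And>x. norm (monomial \<alpha> x *\<^sub>R partials js \<psi> x) \<le> A"
      using Schwartz_bounded[OF assms(1)] unfolding bounded_iff by blast
    obtain B where B: "\<And>x. norm (monomial \<alpha> x *\<^sub>R partials js \<eta> x) \<le> B"
      using Schwartz_bounded[OF assms(2)] unfolding bounded_iff by blast
    have "norm (monomial \<alpha> x *\<^sub>R (a * partials js \<psi> x + b * partials js \<eta> x)) \<le> norm a * A + norm b * B" for x
    proof -
      have "monomial \<alpha> x *\<^sub>R (a * partials js \<psi> x + b * partials js \<eta> x)
        = a * (monomial \<alpha> x *\<^sub>R partials js \<psi> x) + b * (monomial \<alpha> x *\<^sub>R partials js \<eta> x)"
        by (simp add: algebra_simps)
      also have "norm \<dots> \<le> norm a * A + norm b * B"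
        by (rule norm_triangle_mono) (use A B in \<open>simp_all only: norm_mult mult_left_mono norm_ge_zero\<close>)
      finally show ?thesis .
    qed
    then show ?thesis unfolding bounded_iff partials_lincomb[OF assms] by blast
  qed
  show ?thesis using d b by (simp add: Schwartz_def)
qed

lemma Schwartz_continuous: "\<psi> \<in> Schwartz \<Longrightarrow> continuous_on A \<psi>"
  using Schwartz_differentiable[of \<psi> "[]"]
  by (auto intro!: continuous_at_imp_continuous_on differentiable_imp_continuous_within)

lemma Schwartz_measurable [measurable (raw)]:
  "\<psi> \<in> Schwartz \<Longrightarrow> f \<in> borel_measurable M \<Longrightarrow> (\<lambda>x. \<psi> (f x)) \<in> borel_measurable M"
  using borel_measurable_continuous_onI[OF Schwartz_continuous] measurable_compose by blast

text \<open>All test functions are \<open>O(1 / jap)\<close>, and \<open>1 / jap\<close> is integrable.\<close>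

definition jap :: "real ^ 'd::finite \<Rightarrow> real" where
  "jap x = (\<Prod>i\<in>UNIV. 1 + (x $ i)\<^sup>2)"

lemma jap_ge_1: "1 \<le> jap x"
  unfolding jap_def by (rule prod_ge_1) auto

lemma jap_pos: "0 < jap x"
  using jap_ge_1[of x] by linarith

lemma jap_measurable [measurable]: "jap \<in> borel_measurable borel"
  unfolding jap_def[abs_def] by measurable

text \<open>Expanding the product over subsets \<open>B\<close> of the coordinates. This turns the
  seminorms of \<open>Schwartz\<close>, which are stated for monomials, into statements about the
  single weight \<open>jap\<close>.\<close>

lemma jap_eq_sum_monomial:
  "jap x = (\<Sum>B\<in>Pow UNIV. monomial (\<lambda>i. if i \<in> B then 2 else 0) x)"
proof -
  have "jap x = (\<Sum>B\<in>Pow UNIV. (\<Prod>i\<in>UNIV - B. 1) * (\<Prod>i\<in>B. (x $ i)\<^sup>2))"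
    unfolding jap_def by (subst add.commute, subst prod_add) (auto intro!: sum.cong simp: mult.commute)
  also have "\<dots> = (\<Sum>B\<in>Pow UNIV. monomial (\<lambda>i. if i \<in> B then 2 else 0) x)"
  proof (intro sum.cong refl)
    fix B :: "'a set"
    show "(\<Prod>i\<in>UNIV - B. 1) * (\<Prod>i\<in>B. (x $ i)\<^sup>2) = monomial (\<lambda>i. if i \<in> B then 2 else 0) x"
      unfolding monomial_def if_distrib[of "\<lambda>n. _ ^ n"] prod.If_cases[OF finite_class.finite_UNIV] by simp
  qed
  finally show ?thesis .
qed

lemma Schwartz_decay:
  assumes "\<psi> \<in> Schwartz"
  obtains C where "0 \<le> C" "\<And>x. norm (\<psi> x) \<le> C * inverse (jap x)"
proof -
  have "\<forall>B. \<exists>C. \<forall>x. norm (monomial (\<lambda>i. if i \<in> B then 2 else 0) x *\<^sub>R \<psi> x) \<le> C"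
    using Schwartz_bounded[OF assms, of _ "[]"] unfolding bounded_iff by auto
  then obtain C where C: "norm (monomial (\<lambda>i. if i \<in> B then 2 else 0) x *\<^sub>R \<psi> x) \<le> C B" for B x
    by metis
  have le: "norm (\<psi> x) * jap x \<le> (\<Sum>B\<in>Pow UNIV. C B)" for x
  proof -
    have "norm (\<psi> x) * jap x = norm (\<Sum>B\<in>Pow UNIV. monomial (\<lambda>i. if i \<in> B then 2 else 0) x *\<^sub>R \<psi> x)"
      using jap_pos[of x]
      by (simp only: scaleR_sum_left[symmetric] jap_eq_sum_monomial[symmetric]) simp
    also have "\<dots> \<le> (\<Sum>B\<in>Pow UNIV. C B)" by (rule sum_norm_le) (rule C)
    finally show ?thesis .
  qed
  show ?thesis
  proof
    show "0 \<le> (\<Sum>B\<in>Pow UNIV. C B)"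
      using le[of 0] jap_pos[of "0::real^'a"] by (meson mult_nonneg_nonneg norm_ge_zero less_imp_le order_trans)
    show "norm (\<psi> x) \<le> (\<Sum>B\<in>Pow UNIV. C B) * inverse (jap x)" for x
      using le[of x] jap_pos[of x] by (simp add: field_simps)
  qed
qed

lemma Schwartz_tendsto_jap:
  assumes "Schwartz_tendsto \<Psi> \<psi>"
  shows "uniform_limit UNIV (\<lambda>k x. jap x *\<^sub>R \<Psi> k x) (\<lambda>x. jap x *\<^sub>R \<psi> x) sequentially"
proof -
  have "uniform_limit UNIV (\<lambda>k x. \<Sum>B\<in>\<B>. monomial (\<lambda>i. if i \<in> B then 2 else 0) x *\<^sub>R \<Psi> k x)
    (\<lambda>x. \<Sum>B\<in>\<B>. monomial (\<lambda>i. if i \<in> B then 2 else 0) x *\<^sub>R \<psi> x) sequentially" if "finite \<B>" for \<B>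
    using that assms[unfolded Schwartz_tendsto_def, rule_format, of _ "[]"]
    by (induction \<B> rule: finite_induct) (auto intro!: uniform_limit_add uniform_limit_const)
  from this[of "Pow UNIV"] show ?thesis
    unfolding jap_eq_sum_monomial scaleR_sum_left by simp
qed

section \<open>Lebesgue measure as a product\<close>

interpretation lborel_prod: product_sigma_finite "\<lambda>_. lborel :: real measure"
  by standard

lemma vec_lambda_measurable [measurable]:
  "(\<lambda>f. \<chi> i. f i) \<in> borel_measurable (\<Pi>\<^sub>M i\<in>(UNIV::'d::finite set). (lborel :: real measure))"
  unfolding borel_measurable_euclidean_space[of "\<lambda>f. \<chi> i. f i"]
  by (auto simp: Basis_vec_def inner_axis)

text \<open>Lebesgue measure is determined by its values on boxes, where both sides give the product
  of the side lengths. This makes integration coordinate by coordinate available, for Gaussians as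
  well as for orthants.\<close>

lemma lborel_eq_distr_PiM:
  "(lborel :: (real ^ 'd::finite) measure) = distr (\<Pi>\<^sub>M i\<in>UNIV. lborel) borel (\<lambda>f. \<chi> i. f i)"
proof (rule lborel_eqI)
  fix l u :: "real ^ 'd" assume le: "\<And>b. b \<in> Basis \<Longrightarrow> l \<bullet> b \<le> u \<bullet> b"
  have le': "l $ i \<le> u $ i" for i
    using le[of "axis i 1"] by (auto simp: Basis_vec_def inner_axis)
  have "emeasure (distr (\<Pi>\<^sub>M i\<in>UNIV. lborel) borel (\<lambda>f. \<chi> i. f i)) (box l u)
    = emeasure (\<Pi>\<^sub>M i\<in>(UNIV::'d set). lborel) (\<Pi>\<^sub>E i\<in>UNIV. {l $ i<..<u $ i})"
    by (subst emeasure_distr) (auto intro!: arg_cong2[where f=emeasure] simp: mem_box_cart space_PiM PiE_iff)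
  also have "\<dots> = (\<Prod>i\<in>UNIV. emeasure lborel {l $ i<..<u $ i})"
    by (rule lborel_prod.emeasure_PiM) auto
  also have "\<dots> = ennreal (\<Prod>i\<in>UNIV. u $ i - l $ i)"
    using le' by (simp add: prod_ennreal)
  also have "(\<Prod>i\<in>UNIV. u $ i - l $ i) = (\<Prod>b\<in>Basis. (u - l) \<bullet> b)"
    by (simp add: Basis_vec_def UNION_singleton_eq_range prod.reindex inj_on_def axis_eq_axis inner_axis)
  finally show "emeasure (distr (\<Pi>\<^sub>M i\<in>UNIV. lborel) borel (\<lambda>f. \<chi> i. f i)) (box l u)
    = ennreal (\<Prod>b\<in>Basis. (u - l) \<bullet> b)" .
qed simp

lemma integral_lborel_vec:
  fixes f :: "real ^ 'd::finite \<Rightarrow> 'b::{banach, second_countable_topology}"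
  assumes "f \<in> borel_measurable borel"
  shows "(LINT x|lborel. f x) = (LINT h|(\<Pi>\<^sub>M i\<in>UNIV. lborel). f (\<chi> i. h i))"
  using assms by (subst lborel_eq_distr_PiM) (rule integral_distr, auto)

lemma integrable_lborel_vec:
  fixes f :: "real ^ 'd::finite \<Rightarrow> 'b::{banach, second_countable_topology}"
  assumes "f \<in> borel_measurable borel"
  shows "integrable lborel f \<longleftrightarrow> integrable (\<Pi>\<^sub>M i\<in>UNIV. lborel) (\<lambda>h. f (\<chi> i. h i))"
  using assms by (subst lborel_eq_distr_PiM) (rule integrable_distr_eq, auto)

lemma integral_lborel_prod_vec:
  fixes f :: "'d::finite \<Rightarrow> real \<Rightarrow> 'b::{real_normed_field, banach, second_countable_topology}"
  assumes f: "\<And>i. integrable lborel (f i)"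
  shows "integrable lborel (\<lambda>x::real^'d. \<Prod>i\<in>UNIV. f i (x $ i))"
    and "(LINT x|lborel. (\<Prod>i\<in>UNIV. f i (x $ i))) = (\<Prod>i\<in>UNIV. LINT t|lborel. f i t)"
proof -
  have [measurable]: "f i \<in> borel_measurable borel" for i
    using borel_measurable_integrable[OF f[of i]] by simp
  show "integrable lborel (\<lambda>x::real^'d. \<Prod>i\<in>UNIV. f i (x $ i))"
    by (subst integrable_lborel_vec) (use lborel_prod.product_integrable_prod[of UNIV f] f in auto)
  show "(LINT x|lborel. (\<Prod>i\<in>UNIV. f i (x $ i))) = (\<Prod>i\<in>UNIV. LINT t|lborel. f i t)"
    by (subst integral_lborel_vec) (use lborel_prod.product_integral_prod[of UNIV f] f in auto)
qed

lemma integrable_inverse_one_plus_square: "integrable lborel (\<lambda>t::real. inverse (1 + t\<^sup>2))"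
  using integrable_inverse_1_plus_square by (simp add: set_integrable_def)

lemma integrable_inverse_jap: "integrable lborel (\<lambda>x::real^'d::finite. inverse (jap x))"
  using integral_lborel_prod_vec(1)[where 'd='d, OF integrable_inverse_one_plus_square]
  by (simp add: jap_def prod_inversef[symmetric] comp_def)

lemma Schwartz_integrable:
  fixes \<psi> :: "'d::finite test_fun"
  assumes "\<psi> \<in> Schwartz"
  shows "integrable lborel \<psi>"
proof -
  obtain C where C: "0 \<le> C" "\<And>x. norm (\<psi> x) \<le> C * inverse (jap x)"
    using Schwartz_decay[OF assms] by blast
  have "integrable lborel (\<lambda>x::real^'d. C * inverse (jap x))"
    by (intro integrable_mult_right integrable_inverse_jap)
  then show ?thesis
    by (rule Bochner_Integration.integrable_bound)
       (use assms C in \<open>auto intro!: AE_I2 order_trans[OF C(2)] abs_ge_self\<close>)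
qed

section \<open>Decay of the inverse Fourier transform\<close>

lemma integral_lborel_translate:
  fixes f :: "'a::euclidean_space \<Rightarrow> 'b::{banach, second_countable_topology}"
  assumes [measurable]: "f \<in> borel_measurable borel"
  shows "(LINT x|lborel. f (x + c)) = (LINT x|lborel. f x)"
    and "integrable lborel (\<lambda>x. f (x + c)) \<longleftrightarrow> integrable lborel f"
proof -
  show "(LINT x|lborel. f (x + c)) = (LINT x|lborel. f x)"
    by (subst (2) lborel_distr_plus[of c, symmetric]) (simp add: integral_distr add.commute)
  show "integrable lborel (\<lambda>x. f (x + c)) \<longleftrightarrow> integrable lborel f"
    by (subst (2) lborel_distr_plus[of c, symmetric]) (simp add: integrable_distr_eq add.commute)
qed

lemma has_vector_derivative_partial:
  assumes "\<eta> differentiable (at (x + u *\<^sub>R axis j 1))"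
  shows "((\<lambda>u. \<eta> (x + u *\<^sub>R axis j 1)) has_vector_derivative partial j \<eta> (x + u *\<^sub>R axis j 1)) (at u)"
proof -
  have "(\<eta> has_derivative frechet_derivative \<eta> (at (x + u *\<^sub>R axis j 1))) (at (x + u *\<^sub>R axis j 1))"
    using assms frechet_derivative_works by blast
  then have "((\<lambda>u. \<eta> (x + u *\<^sub>R axis j 1)) has_derivative
      (\<lambda>h. frechet_derivative \<eta> (at (x + u *\<^sub>R axis j 1)) (h *\<^sub>R axis j 1))) (at u)"
    by (rule has_derivative_compose[rotated]) (auto intro!: derivative_eq_intros)
  moreover have "linear (frechet_derivative \<eta> (at (x + u *\<^sub>R axis j 1)))"
    using assms linear_frechet_derivative by blast
  ultimately show ?thesis
    by (simp add: has_vector_derivative_def partial_def linear_scale)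
qed

text \<open>Integrating \<open>\<eta>(x + e\<^sub>j) - \<eta>(x) = \<integral>\<^sub>0\<^sup>1 \<partial>\<^sub>j\<eta>(x + u e\<^sub>j) du\<close> over \<open>x\<close>, translation invariance makes the left-hand
  side vanish and Fubini turns the right-hand side into \<open>\<integral> \<partial>\<^sub>j\<eta>\<close>.\<close>

lemma integral_partial_eq_0:
  fixes \<eta> :: "'d::finite test_fun"
  assumes diff: "\<And>x. \<eta> differentiable (at x)"
    and cont: "continuous_on UNIV (partial j \<eta>)"
    and int: "integrable lborel \<eta>" "integrable lborel (partial j \<eta>)"
  shows "(LINT x|lborel. partial j \<eta> x) = 0"
proof -
  let ?e = "axis j 1 :: real^'d"
  let ?F = "\<lambda>u x. indicator {0..1::real} u *\<^sub>R partial j \<eta> (x + u *\<^sub>R ?e)"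
  have [measurable]: "\<eta> \<in> borel_measurable borel" "partial j \<eta> \<in> borel_measurable borel"
    using int by auto
  have FTC: "(LINT u|lborel. ?F u x) = \<eta> (x + ?e) - \<eta> x" for x
    by (subst integral_FTC_atLeastAtMost[of 0 1 "\<lambda>u. \<eta> (x + u *\<^sub>R ?e)"])
       (auto intro!: has_vector_derivative_at_within has_vector_derivative_partial diff
        continuous_on_compose2[OF cont] continuous_intros)
  have "integrable (lborel \<Otimes>\<^sub>M lborel) (\<lambda>(u, x). ?F u x)"
  proof (rule lborel_pair.Fubini_integrable)
    \<comment> \<open>By translation invariance the inner integral depends on \<open>u\<close> only
      through the indicator, so the double integral is finite.\<close>
    have "(LINT x|lborel. norm (case (u, x) of (u, x) \<Rightarrow> ?F u x))
        = indicator {0..1} u *\<^sub>R (LINT x|lborel. norm (partial j \<eta> x))" for u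
      by (simp add: integral_lborel_translate(1)[of "\<lambda>x. norm (partial j \<eta> x)"])
    then show "integrable lborel (\<lambda>u. LINT x|lborel. norm (case (u, x) of (u, x) \<Rightarrow> ?F u x))"
      by (simp only:) simp
    show "AE u in lborel. integrable lborel (\<lambda>x. case (u, x) of (u, x) \<Rightarrow> ?F u x)"
      using int(2) by (simp add: integral_lborel_translate(2)[of "partial j \<eta>"])
  qed measurable
  from lborel_pair.Fubini_integral[OF this]
  have "(LINT x|lborel. LINT u|lborel. ?F u x) = (LINT u|lborel. LINT x|lborel. ?F u x)" by simp
  also have "\<dots> = (LINT u|lborel. indicator {0..1::real} u *\<^sub>R (LINT x|lborel. partial j \<eta> x))"
    by (simp add: integral_lborel_translate(1)[of "partial j \<eta>"])
  also have "\<dots> = (LINT x|lborel. partial j \<eta> x)" by simp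
  finally have "(LINT x|lborel. partial j \<eta> x) = (LINT x|lborel. \<eta> (x + ?e) - \<eta> x)"
    by (simp add: FTC)
  also have "\<dots> = 0"
    using int(1) by (subst Bochner_Integration.integral_diff) (simp_all add: integral_lborel_translate)
  finally show ?thesis .
qed

lemma integrable_mult_iexp:
  fixes f :: "'a \<Rightarrow> complex"
  assumes "integrable M f" "h \<in> borel_measurable M"
  shows "integrable M (\<lambda>x. f x * iexp (h x))"
  by (rule Bochner_Integration.integrable_bound[OF assms(1)])
     (use assms in \<open>auto simp: norm_mult intro!: AE_I2 borel_measurable_times measurable_compose[OF _ borel_measurable_exp]\<close>)

lemma inv_fourier_lincomb:
  assumes "integrable lborel \<psi>" "integrable lborel \<eta>"
  shows "inv_fourier (\<lambda>x. a * \<psi> x + b * \<eta> x) s = a * inv_fourier \<psi> s + b * inv_fourier \<eta> s"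
proof -
  have "(LINT x|lborel. (a * \<psi> x + b * \<eta> x) * iexp (- (s \<bullet> x)))
    = (LINT x|lborel. a * (\<psi> x * iexp (- (s \<bullet> x))) + b * (\<eta> x * iexp (- (s \<bullet> x))))"
    by (simp add: algebra_simps)
  also have "\<dots> = a * (LINT x|lborel. \<psi> x * iexp (- (s \<bullet> x))) + b * (LINT x|lborel. \<eta> x * iexp (- (s \<bullet> x)))"
    using integrable_mult_iexp[OF assms(1), of "\<lambda>x. - (s \<bullet> x)"] integrable_mult_iexp[OF assms(2), of "\<lambda>x. - (s \<bullet> x)"]
    by (subst Bochner_Integration.integral_add) auto
  finally show ?thesis by (simp add: inv_fourier_def add_divide_distrib)
qed

lemma inv_fourier_measurable [measurable]:
  assumes [measurable]: "\<psi> \<in> borel_measurable borel"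
  shows "inv_fourier \<psi> \<in> borel_measurable borel"
  unfolding inv_fourier_def[abs_def] by measurable

text \<open>Integration by parts: the partial derivative of
  \<open>\<psi> x * iexp (- (s \<bullet> x))\<close> has integral 0, and the product rule splits it
  into the two sides.\<close>

lemma inv_fourier_partial:
  assumes "\<psi> \<in> Schwartz"
  shows "inv_fourier (partial j \<psi>) s = \<i> * complex_of_real (s $ j) * inv_fourier \<psi> s"
proof -
  let ?\<eta> = "\<lambda>x. \<psi> x * iexp (- (s \<bullet> x))"
  have D: "(?\<eta> has_derivative (\<lambda>h. \<psi> x * (- \<i> * complex_of_real (s \<bullet> h) * iexp (- (s \<bullet> x)))
      + frechet_derivative \<psi> (at x) h * iexp (- (s \<bullet> x)))) (at x)" for x
  proof -
    have "((\<lambda>x. \<i> * complex_of_real (- (s \<bullet> x))) has_derivative (\<lambda>h. \<i> * complex_of_real (- (s \<bullet> h)))) (at x)"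
      by (auto intro!: derivative_eq_intros)
    from has_derivative_compose[OF this DERIV_exp[unfolded has_field_derivative_def]]
    have E: "((\<lambda>x. iexp (- (s \<bullet> x))) has_derivative (\<lambda>h. - \<i> * complex_of_real (s \<bullet> h) * iexp (- (s \<bullet> x)))) (at x)"
      by (simp add: algebra_simps)
    have "(\<psi> has_derivative frechet_derivative \<psi> (at x)) (at x)"
      using Schwartz_differentiable[OF assms, of "[]" x] by (simp add: frechet_derivative_works)
    from has_derivative_mult[OF this E] show ?thesis by simp
  qed
  have P: "partial j ?\<eta> = (\<lambda>x. partial j \<psi> x * iexp (- (s \<bullet> x)) - \<i> * complex_of_real (s $ j) * ?\<eta> x)"
    using partial_eqI[OF D] by (simp add: fun_eq_iff partial_def inner_axis algebra_simps)
  have int: "integrable lborel (\<lambda>x. partial j \<psi> x * iexp (- (s \<bullet> x)))" "integrable lborel ?\<eta>"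
    by (intro integrable_mult_iexp Schwartz_integrable partial_Schwartz assms; simp)+
  have "0 = (LINT x|lborel. partial j ?\<eta> x)"
  proof (rule integral_partial_eq_0[symmetric])
    show "?\<eta> differentiable (at x)" for x using D differentiable_def by blast
    show "continuous_on UNIV (partial j ?\<eta>)"
      unfolding P by (intro continuous_intros Schwartz_continuous partial_Schwartz assms)
    show "integrable lborel (partial j ?\<eta>)"
      unfolding P by (intro Bochner_Integration.integrable_diff integrable_mult_right int)
  qed (rule int)
  also have "\<dots> = (LINT x|lborel. partial j \<psi> x * iexp (- (s \<bullet> x))) - \<i> * complex_of_real (s $ j) * (LINT x|lborel. ?\<eta> x)"
    unfolding P using int by (subst Bochner_Integration.integral_diff) (auto intro: integrable_mult_right)
  finally show ?thesis by (simp add: inv_fourier_def)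
qed

section \<open>Iterated second-order operators and polynomial weights\<close>

text \<open>The coefficients \<open>1\<close> and \<open>- 1\<close> are spelled out so that the
  body is an instance of the linear combinations in \<open>Schwartz_lincomb\<close>,
  \<open>partials_lincomb\<close> and \<open>inv_fourier_lincomb\<close>.\<close>

definition one_minus_laplace :: "'d::finite \<Rightarrow> 'd test_fun \<Rightarrow> 'd test_fun" where
  "one_minus_laplace j \<psi> = (\<lambda>x. 1 * \<psi> x + (- 1) * partials [j, j] \<psi> x)"

lemma one_minus_laplace_Schwartz: "\<psi> \<in> Schwartz \<Longrightarrow> one_minus_laplace j \<psi> \<in> Schwartz"
  unfolding one_minus_laplace_def by (intro Schwartz_lincomb partials_Schwartz)

lemma inv_fourier_one_minus_laplace:
  assumes "\<psi> \<in> Schwartz"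
  shows "inv_fourier (one_minus_laplace j \<psi>) s = complex_of_real (1 + (s $ j)\<^sup>2) * inv_fourier \<psi> s"
proof -
  have "inv_fourier (partials [j, j] \<psi>) s = - complex_of_real ((s $ j)\<^sup>2) * inv_fourier \<psi> s"
    using assms
    by (simp add: partials_Cons inv_fourier_partial partial_Schwartz power2_eq_square algebra_simps)
  then show ?thesis
    unfolding one_minus_laplace_def
    by (subst inv_fourier_lincomb) (simp_all add: Schwartz_integrable partials_Schwartz assms algebra_simps)
qed

text \<open>Every seminorm expression of the image is a difference of two seminorm expressions of
  the argument, the second one with \<open>[j, j]\<close> appended to the list of
  derivatives.\<close>

lemma Schwartz_tendsto_one_minus_laplace:
  assumes "\<And>k. \<Psi> k \<in> Schwartz" "\<psi> \<in> Schwartz" "Schwartz_tendsto \<Psi> \<psi>"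
  shows "Schwartz_tendsto (\<lambda>k. one_minus_laplace j (\<Psi> k)) (one_minus_laplace j \<psi>)"
proof -
  have *: "monomial \<alpha> x *\<^sub>R partials is (one_minus_laplace j \<eta>) x
    = monomial \<alpha> x *\<^sub>R partials is \<eta> x - monomial \<alpha> x *\<^sub>R partials (is @ [j, j]) \<eta> x"
    if "\<eta> \<in> Schwartz" for \<eta> \<alpha> x "is"
    unfolding one_minus_laplace_def partials_lincomb[OF that partials_Schwartz[OF that]]
    by (simp add: partials_append algebra_simps)
  show ?thesis
    unfolding Schwartz_tendsto_def *[OF assms(1)] *[OF assms(2)]
    by (intro allI uniform_limit_minus) (use assms(3)[unfolded Schwartz_tendsto_def] in blast)+
qed

abbreviation one_minus_laplaces :: "'d::finite list \<Rightarrow> 'd test_fun \<Rightarrow> 'd test_fun" where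
  "one_minus_laplaces js \<psi> \<equiv> foldr one_minus_laplace js \<psi>"

lemma one_minus_laplaces_Schwartz: "\<psi> \<in> Schwartz \<Longrightarrow> one_minus_laplaces js \<psi> \<in> Schwartz"
  by (induction js) (simp_all add: one_minus_laplace_Schwartz)

lemma inv_fourier_one_minus_laplaces:
  "\<psi> \<in> Schwartz \<Longrightarrow> inv_fourier (one_minus_laplaces js \<psi>) s
    = complex_of_real (\<Prod>j\<leftarrow>js. 1 + (s $ j)\<^sup>2) * inv_fourier \<psi> s"
  by (induction js) (simp_all add: inv_fourier_one_minus_laplace one_minus_laplaces_Schwartz)

lemma Schwartz_tendsto_one_minus_laplaces:
  assumes "\<And>k. \<Psi> k \<in> Schwartz" "\<psi> \<in> Schwartz" "Schwartz_tendsto \<Psi> \<psi>"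
  shows "Schwartz_tendsto (\<lambda>k. one_minus_laplaces js (\<Psi> k)) (one_minus_laplaces js \<psi>)"
  by (induction js)
     (simp_all add: assms Schwartz_tendsto_one_minus_laplace one_minus_laplaces_Schwartz)

text \<open>The list repeats each coordinate \<open>i\<close> exactly \<open>m i\<close> times.
  Applying \<open>one_minus_laplaces\<close> along it multiplies the transform by the reciprocal of
  the weight belonging to \<open>m\<close>.\<close>

lemma prod_list_of_multiplicities:
  fixes m :: "'d::finite \<Rightarrow> nat"
  obtains js where "\<And>c :: 'd \<Rightarrow> 'b::comm_monoid_mult. (\<Prod>j\<leftarrow>js. c j) = (\<Prod>i\<in>UNIV. c i ^ m i)"
proof -
  have "\<exists>js. \<forall>c :: 'd \<Rightarrow> 'b. (\<Prod>j\<leftarrow>js. c j) = (\<Prod>i\<in>A. c i ^ m i)" if "finite A" for A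
    using that
  proof (induction A)
    case (insert i A)
    then obtain js where "\<forall>c :: 'd \<Rightarrow> 'b. (\<Prod>j\<leftarrow>js. c j) = (\<Prod>i\<in>A. c i ^ m i)" by blast
    moreover have "(\<Prod>j\<leftarrow>replicate n i. c j) = c i ^ n" for n and c :: "'d \<Rightarrow> 'b"
      by (induction n) simp_all
    ultimately show ?case
      using insert.hyps by (intro exI[of _ "replicate (m i) i @ js"]) simp
  qed (auto intro: exI[of _ "[]"])
  from this[of UNIV] that show thesis by auto
qed

text \<open>The factor in the integrability hypothesis on \<open>inverse \<phi>\<close>. For
  \<open>m\<close> constantly 1 it is the reciprocal of \<open>jap\<close>.\<close>

definition weight :: "('d::finite \<Rightarrow> nat) \<Rightarrow> real ^ 'd \<Rightarrow> real" where
  "weight m t = (\<Prod>i\<in>UNIV. inverse ((1 + (t $ i)\<^sup>2) ^ m i))"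

lemma weight_pos: "0 < weight m t"
  unfolding weight_def by (intro prod_pos) (auto intro!: zero_less_power add_pos_nonneg)

lemma weight_measurable [measurable]: "weight m \<in> borel_measurable borel"
  unfolding weight_def[abs_def] by measurable

text \<open>\<open>js\<close> and \<open>K\<close> depend on \<open>m\<close> alone and
  \<open>\<psi>\<close> enters only through \<open>C\<close>. For one fixed \<open>\<psi>\<close>
  this is decay of the transform; applied to differences \<open>\<Psi> k - \<psi>\<close> it gives
  continuity on \<open>Schwartz\<close>.\<close>

lemma inv_fourier_weight_bound:
  fixes m :: "'d::finite \<Rightarrow> nat"
  obtains js K where "0 \<le> K"
    "\<And>\<psi> C s. \<psi> \<in> Schwartz \<Longrightarrow> (\<And>x. norm (jap x *\<^sub>R one_minus_laplaces js \<psi> x) \<le> C) \<Longrightarrow>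
      norm (inv_fourier \<psi> s) \<le> K * C * weight m s"
proof -
  obtain js where js: "(\<Prod>j\<leftarrow>js. c j) = (\<Prod>i\<in>UNIV. c i ^ m i)" for c :: "'d \<Rightarrow> real"
    using prod_list_of_multiplicities[of m] by metis
  \<comment> \<open>The integral of the majorant \<open>inverse (jap x)\<close>, with the
    normalization of \<open>inv_fourier\<close>.\<close>
  define K where "K = (LINT x::real^'d|lborel. inverse (jap x)) / (2 * pi) ^ CARD('d)"
  have K: "0 \<le> K"
    unfolding K_def by (intro divide_nonneg_nonneg integral_nonneg_AE AE_I2) (auto simp: less_imp_le[OF jap_pos])
  have "norm (inv_fourier \<psi> s) \<le> K * C * weight m s"
    if \<psi>: "\<psi> \<in> Schwartz" and C: "\<And>x. norm (jap x *\<^sub>R one_minus_laplaces js \<psi> x) \<le> C" for \<psi> C s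
  proof -
    let ?\<eta> = "one_minus_laplaces js \<psi>"
    have int: "integrable lborel ?\<eta>" by (intro Schwartz_integrable one_minus_laplaces_Schwartz \<psi>)
    have "norm (LINT x|lborel. ?\<eta> x * iexp (- (s \<bullet> x))) \<le> (LINT x::real^'d|lborel. C * inverse (jap x))"
    proof (rule Bochner_Integration.integral_norm_bound_integral)
      show "integrable lborel (\<lambda>x. ?\<eta> x * iexp (- (s \<bullet> x)))" by (intro integrable_mult_iexp int) simp
      show "integrable lborel (\<lambda>x::real^'d. C * inverse (jap x))"
        by (intro integrable_mult_right integrable_inverse_jap)
      show "norm (?\<eta> x * iexp (- (s \<bullet> x))) \<le> C * inverse (jap x)" for x
        using C[of x] jap_pos[of x] by (simp add: norm_mult field_simps)
    qed
    then have "norm (inv_fourier ?\<eta> s) \<le> K * C"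
      by (simp add: inv_fourier_def norm_divide norm_mult norm_power K_def divide_right_mono mult.commute)
    moreover have pos: "0 < (\<Prod>i\<in>UNIV. (1 + (s $ i)\<^sup>2) ^ m i)"
      by (intro prod_pos) (auto intro!: zero_less_power add_pos_nonneg)
    ultimately have "(\<Prod>i\<in>UNIV. (1 + (s $ i)\<^sup>2) ^ m i) * norm (inv_fourier \<psi> s) \<le> K * C"
      unfolding inv_fourier_one_minus_laplaces[OF \<psi>] js
      by (simp only: norm_mult norm_of_real abs_of_pos[OF pos])
    moreover have "weight m s = inverse (\<Prod>i\<in>UNIV. (1 + (s $ i)\<^sup>2) ^ m i)"
      by (simp add: weight_def prod_inversef[symmetric] comp_def)
    moreover note pos
    ultimately show ?thesis by (simp add: field_simps)
  qed
  with K that show thesis by blast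
qed

lemma inv_fourier_decay:
  assumes "\<psi> \<in> Schwartz"
  obtains C where "0 \<le> C" "\<And>s. norm (inv_fourier \<psi> s) \<le> C * weight m s"
proof -
  obtain js K where K: "0 \<le> K" and bound:
    "\<And>\<psi> C s. \<psi> \<in> Schwartz \<Longrightarrow> (\<And>x. norm (jap x *\<^sub>R one_minus_laplaces js \<psi> x) \<le> C) \<Longrightarrow>
      norm (inv_fourier \<psi> s) \<le> K * C * weight m s"
    using inv_fourier_weight_bound[of m] by metis
  obtain C where C: "0 \<le> C" "\<And>x. norm (one_minus_laplaces js \<psi> x) \<le> C * inverse (jap x)"
    using Schwartz_decay[OF one_minus_laplaces_Schwartz[OF assms]] by metis
  have "norm (jap x *\<^sub>R one_minus_laplaces js \<psi> x) \<le> C" for x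
    using C(2)[of x] jap_pos[of x] by (simp add: field_simps)
  from bound[OF assms this] K C(1) that[of "K * C"] show thesis by simp
qed

text \<open>Decay with all multiplicities equal to 1 is decay like \<open>inverse (jap s)\<close>,
  which is integrable.\<close>

lemma inv_fourier_Schwartz_integrable:
  fixes \<psi> :: "'d::finite test_fun"
  assumes "\<psi> \<in> Schwartz"
  shows "integrable lborel (inv_fourier \<psi>)"
proof -
  obtain C where C: "norm (inv_fourier \<psi> s) \<le> C * weight (\<lambda>_. 1) s" for s
    using inv_fourier_decay[OF assms, of "\<lambda>_. 1"] by metis
  have w: "weight (\<lambda>_. 1) s = inverse (jap s)" for s :: "real^'d"
    by (simp add: weight_def jap_def prod_inversef[symmetric] comp_def)
  have "integrable lborel (\<lambda>x::real^'d. C * inverse (jap x))"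
    by (intro integrable_mult_right integrable_inverse_jap)
  then show ?thesis
    by (rule Bochner_Integration.integrable_bound)
       (use assms C in \<open>auto intro!: AE_I2 order_trans[OF C] abs_ge_self inv_fourier_measurable Schwartz_measurable simp: w simp del: One_nat_def\<close>)
qed

lemma integrable_mult_inv_fourier:
  fixes \<psi> :: "'d::finite test_fun"
  assumes [measurable]: "b \<in> borel_measurable borel"
    and int: "integrable lborel (\<lambda>t. weight m t * norm (b t))" and \<psi>: "\<psi> \<in> Schwartz"
  shows "integrable lborel (\<lambda>s. b s * inv_fourier \<psi> s)"
proof -
  have [measurable]: "\<psi> \<in> borel_measurable borel"
    by (intro borel_measurable_continuous_onI Schwartz_continuous \<psi>)
  obtain C where C: "norm (inv_fourier \<psi> s) \<le> C * weight m s" for s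
    using inv_fourier_decay[OF \<psi>, of m] by metis
  show ?thesis
  proof (rule Bochner_Integration.integrable_bound)
    show "integrable lborel (\<lambda>t. C * (weight m t * norm (b t)))" using int by simp
    show "AE s in lborel. norm (b s * inv_fourier \<psi> s) \<le> norm (C * (weight m s * norm (b s)))"
    proof (rule AE_I2)
      fix s
      have "norm (b s * inv_fourier \<psi> s) \<le> norm (b s) * (C * weight m s)"
        unfolding norm_mult by (intro mult_left_mono C) simp
      also have "\<dots> \<le> norm (C * (weight m s * norm (b s)))" by (simp add: ac_simps)
      finally show "norm (b s * inv_fourier \<psi> s) \<le> norm (C * (weight m s * norm (b s)))" .
    qed
  qed measurable
qed

text \<open>For continuity, \<open>inv_fourier_weight_bound\<close> is applied to
  \<open>\<Psi> k - \<psi>\<close>: if \<open>jap\<close> times its image under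
  \<open>one_minus_laplaces js\<close> is uniformly at most \<open>\<delta>\<close>, the functional
  changes by at most \<open>K * I * \<delta>\<close>.\<close>

lemma Ft_inv_regular_tempered:
  fixes m :: "'d::finite \<Rightarrow> nat"
  assumes [measurable]: "b \<in> borel_measurable borel"
    and int: "integrable lborel (\<lambda>t. weight m t * norm (b t))"
  shows "Ft_inv (regular b) \<in> tempered"
proof -
  note int_b = integrable_mult_inv_fourier[OF assms]
  have lin: "Ft_inv (regular b) (\<lambda>x. c * \<psi> x + d * \<eta> x) = c * Ft_inv (regular b) \<psi> + d * Ft_inv (regular b) \<eta>"
    if "\<psi> \<in> Schwartz" "\<eta> \<in> Schwartz" for \<psi> \<eta> c d
  proof -
    have "Ft_inv (regular b) (\<lambda>x. c * \<psi> x + d * \<eta> x)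
      = (LINT s|lborel. c * (b s * inv_fourier \<psi> s) + d * (b s * inv_fourier \<eta> s))"
      unfolding Ft_inv_def regular_def
      by (simp add: inv_fourier_lincomb Schwartz_integrable that algebra_simps)
    also have "\<dots> = c * Ft_inv (regular b) \<psi> + d * Ft_inv (regular b) \<eta>"
      unfolding Ft_inv_def regular_def using int_b[OF that(1)] int_b[OF that(2)]
      by (subst Bochner_Integration.integral_add) auto
    finally show ?thesis .
  qed
  have cont: "(\<lambda>k. Ft_inv (regular b) (\<Psi> k)) \<longlonglongrightarrow> Ft_inv (regular b) \<psi>"
    if \<psi>: "\<psi> \<in> Schwartz" and \<Psi>: "\<And>k. \<Psi> k \<in> Schwartz" and lim: "Schwartz_tendsto \<Psi> \<psi>" for \<Psi> \<psi>
  proof -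
    obtain js K where K: "0 \<le> K" and bound:
      "\<And>\<psi> C s. \<psi> \<in> Schwartz \<Longrightarrow> (\<And>x. norm (jap x *\<^sub>R one_minus_laplaces js \<psi> x) \<le> C) \<Longrightarrow>
        norm (inv_fourier \<psi> s) \<le> K * C * weight m s"
      using inv_fourier_weight_bound[of m] by metis
    define I where "I = (LINT t|lborel. weight m t * norm (b t))"
    have I: "0 \<le> I" unfolding I_def by (intro integral_nonneg_AE AE_I2) (simp add: less_imp_le[OF weight_pos])
    have ul: "uniform_limit UNIV (\<lambda>k x. jap x *\<^sub>R one_minus_laplaces js (\<Psi> k) x)
        (\<lambda>x. jap x *\<^sub>R one_minus_laplaces js \<psi> x) sequentially"
      by (intro Schwartz_tendsto_jap Schwartz_tendsto_one_minus_laplaces \<Psi> \<psi> lim)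
    show ?thesis
    proof (rule metric_LIMSEQ_I)
      fix e :: real assume e: "0 < e"
      \<comment> \<open>The summand 1 keeps the denominator positive even when
        \<open>K * I = 0\<close>.\<close>
      define \<delta> where "\<delta> = e / (2 * (K * I + 1))"
      have pos: "0 < K * I + 1" using K I by (simp add: add_nonneg_pos)
      have \<delta>: "0 < \<delta>" using e pos by (simp add: \<delta>_def)
      obtain N where N: "\<And>k x. k \<ge> N \<Longrightarrow> dist (jap x *\<^sub>R one_minus_laplaces js (\<Psi> k) x) (jap x *\<^sub>R one_minus_laplaces js \<psi> x) < \<delta>"
        using uniform_limitD[OF ul \<delta>] unfolding eventually_sequentially by blast
      have "dist (Ft_inv (regular b) (\<Psi> k)) (Ft_inv (regular b) \<psi>) < e" if "k \<ge> N" for k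
      proof -
        let ?\<eta> = "\<lambda>x. 1 * \<Psi> k x + (- 1) * \<psi> x"
        have \<eta>: "?\<eta> \<in> Schwartz" by (intro Schwartz_lincomb \<Psi> \<psi>)
        \<comment> \<open>The operators distribute over the difference. This goes one operator at a
          time, since linearity of \<open>partials\<close> is available on \<open>Schwartz\<close>
          only and each intermediate function must be known to lie there.\<close>
        have oml: "one_minus_laplaces is ?\<eta> = (\<lambda>x. 1 * one_minus_laplaces is (\<Psi> k) x + (- 1) * one_minus_laplaces is \<psi> x)" for "is"
        proof (induction "is")
          case (Cons i js)
          show ?case
            by (simp only: foldr.simps comp_apply Cons.IH)
               (simp add: one_minus_laplace_def[of i] fun_eq_iff algebra_simps
                  partials_lincomb[OF one_minus_laplaces_Schwartz[OF \<Psi>] one_minus_laplaces_Schwartz[OF \<psi>], where a=1 and b="-1", simplified])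
        qed simp
        have ineq: "norm (inv_fourier ?\<eta> s) \<le> K * \<delta> * weight m s" for s
        proof (rule bound[OF \<eta>])
          show "norm (jap x *\<^sub>R one_minus_laplaces js ?\<eta> x) \<le> \<delta>" for x
            using N[OF that, of x] unfolding oml by (simp add: dist_norm scaleR_diff_right[symmetric])
        qed
        have "norm (b s * inv_fourier ?\<eta> s) \<le> (K * \<delta>) * (weight m s * norm (b s))" for s
          using mult_left_mono[OF ineq norm_ge_zero[of "b s"], of s] by (simp add: norm_mult ac_simps)
        then have "norm (Ft_inv (regular b) ?\<eta>) \<le> (LINT s|lborel. (K * \<delta>) * (weight m s * norm (b s)))"
          unfolding Ft_inv_def regular_def
          by (intro Bochner_Integration.integral_norm_bound_integral int_b[OF \<eta>] integrable_mult_right int)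
        also have "\<dots> = (K * I) * \<delta>" by (simp add: I_def)
        also have "\<dots> < (K * I + 1) * (2 * \<delta>)" using \<delta> K I by (simp add: algebra_simps add_nonneg_pos)
        also have "\<dots> = e" using pos by (simp add: \<delta>_def divide_simps)
        finally show ?thesis
          using lin[OF \<Psi> \<psi>, of 1 k "-1"] by (simp add: dist_norm)
      qed
      then show "\<exists>N. \<forall>k\<ge>N. dist (Ft_inv (regular b) (\<Psi> k)) (Ft_inv (regular b) \<psi>) < e" by blast
    qed
  qed
  have "Ft_inv (regular b) (\<lambda>x. \<psi> x + \<eta> x) = Ft_inv (regular b) \<psi> + Ft_inv (regular b) \<eta>"
    if "\<psi> \<in> Schwartz" "\<eta> \<in> Schwartz" for \<psi> \<eta> using lin[OF that, of 1 1] by simp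
  moreover have "Ft_inv (regular b) (\<lambda>x. c * \<psi> x) = c * Ft_inv (regular b) \<psi>"
    if "\<psi> \<in> Schwartz" for \<psi> c using lin[OF that that, of c 0] by simp
  ultimately show ?thesis using cont unfolding tempered_def by blast
qed

section \<open>Gaussian smoothing, Fourier inversion and uniqueness\<close>

text \<open>Left unnormalized: in this form it is its own Fourier transform up to the factor
  \<open>sqrt (2 * pi) ^ CARD('d)\<close>, which is also its integral.\<close>

definition gauss :: "real ^ 'd::finite \<Rightarrow> real" where
  "gauss x = exp (- (x \<bullet> x) / 2)"

lemma gauss_measurable [measurable]: "gauss \<in> borel_measurable borel"
  unfolding gauss_def[abs_def] by measurable

lemma gauss_bounds: "0 < gauss x" "gauss x \<le> 1"
  by (simp_all add: gauss_def)

lemma abs_gauss [simp]: "\<bar>gauss x\<bar> = gauss x"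
  by (simp add: gauss_def)

text \<open>This is the characteristic function of the standard normal distribution, with the
  normalizing constant of the density moved to the other side.\<close>

lemma gauss_fourier_real:
  shows "integrable lborel (\<lambda>u. complex_of_real (exp (- u\<^sup>2 / 2)) * iexp (a * u))"
    and "(LINT u|lborel. complex_of_real (exp (- u\<^sup>2 / 2)) * iexp (a * u))
      = complex_of_real (sqrt (2 * pi) * exp (- a\<^sup>2 / 2))"
proof -
  have "integrable lborel (\<lambda>u. sqrt (2 * pi) * std_normal_density u)"
    by (intro integrable_mult_right integrable_normal_density) simp
  then have "integrable lborel (\<lambda>u::real. exp (- u\<^sup>2 / 2))"
    by (simp add: std_normal_density_def)
  then have "integrable lborel (\<lambda>u::real. complex_of_real (exp (- u\<^sup>2 / 2)))"
    by (rule integrable_of_real)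
  from integrable_mult_iexp[OF this, of "\<lambda>u. a * u"]
  show int: "integrable lborel (\<lambda>u. complex_of_real (exp (- u\<^sup>2 / 2)) * iexp (a * u))"
    by simp
  have "complex_of_real (exp (- a\<^sup>2 / 2)) = char std_normal_distribution a"
    by (simp add: char_std_normal_distribution)
  also have "\<dots> = (LINT u|lborel. std_normal_density u *\<^sub>R iexp (a * u))"
    unfolding char_def by (subst integral_density) (auto intro!: AE_I2 borel_measurable_continuous_onI continuous_intros)
  also have "\<dots> = (LINT u|lborel. complex_of_real (1 / sqrt (2 * pi)) * (complex_of_real (exp (- u\<^sup>2 / 2)) * iexp (a * u)))"
    by (simp add: std_normal_density_def scaleR_conv_of_real)
  finally have "complex_of_real (sqrt (2 * pi)) * complex_of_real (exp (- a\<^sup>2 / 2))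
     = complex_of_real (sqrt (2 * pi)) * (complex_of_real (1 / sqrt (2 * pi)) * (LINT u|lborel. (complex_of_real (exp (- u\<^sup>2 / 2)) * iexp (a * u))))"
    by simp
  then show "(LINT u|lborel. complex_of_real (exp (- u\<^sup>2 / 2)) * iexp (a * u))
      = complex_of_real (sqrt (2 * pi) * exp (- a\<^sup>2 / 2))"
    unfolding mult.assoc[symmetric] of_real_mult[symmetric] by simp
qed

text \<open>Both the Gaussian and the phase factor over the coordinates, so the integral is a
  product of one-dimensional ones.\<close>

lemma gauss_fourier:
  fixes t :: "real ^ 'd::finite"
  shows "integrable lborel (\<lambda>x. complex_of_real (gauss x) * iexp (t \<bullet> x))"
    and "(LINT x|lborel. complex_of_real (gauss x) * iexp (t \<bullet> x))
      = complex_of_real (sqrt (2 * pi) ^ CARD('d) * gauss t)"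
proof -
  have eq: "complex_of_real (gauss x) * iexp (t \<bullet> x)
    = (\<Prod>i\<in>UNIV. complex_of_real (exp (- (x $ i)\<^sup>2 / 2)) * iexp (t $ i * x $ i))" for x
  proof -
    have "gauss x = (\<Prod>i\<in>UNIV. exp (- (x $ i)\<^sup>2 / 2))"
      by (simp add: gauss_def inner_vec_def power2_eq_square exp_sum[symmetric] sum_negf sum_divide_distrib)
    moreover have "iexp (t \<bullet> x) = (\<Prod>i\<in>UNIV. iexp (t $ i * x $ i))"
      by (simp add: inner_vec_def exp_sum[symmetric] sum_distrib_left)
    ultimately show ?thesis by (simp add: prod.distrib)
  qed
  show "integrable lborel (\<lambda>x. complex_of_real (gauss x) * iexp (t \<bullet> x))"
    unfolding eq by (rule integral_lborel_prod_vec(1)) (rule gauss_fourier_real(1))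
  have "(\<Prod>i\<in>UNIV. sqrt (2 * pi) * exp (- (t $ i)\<^sup>2 / 2)) = sqrt (2 * pi) ^ CARD('d) * gauss t"
    by (simp add: prod.distrib gauss_def inner_vec_def power2_eq_square exp_sum[symmetric] sum_negf sum_divide_distrib)
  then show "(LINT x|lborel. complex_of_real (gauss x) * iexp (t \<bullet> x))
      = complex_of_real (sqrt (2 * pi) ^ CARD('d) * gauss t)"
    unfolding eq integral_lborel_prod_vec(2)[OF gauss_fourier_real(1)] gauss_fourier_real(2)
    by (simp only: of_real_prod[symmetric])
qed

lemma gauss_integrable: "integrable lborel (gauss :: real ^ 'd::finite \<Rightarrow> real)"
  using integrable_norm[OF gauss_fourier(1)[of "0::real^'d"]] by (simp add: abs_of_pos gauss_bounds)

lemma gauss_integral: "(LINT x|lborel. gauss (x::real ^ 'd::finite)) = sqrt (2 * pi) ^ CARD('d)"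
proof -
  have "complex_of_real (LINT x|lborel. gauss (x::real ^ 'd::finite)) = complex_of_real (sqrt (2 * pi) ^ CARD('d))"
    using gauss_fourier(2)[of "0::real^'d"] unfolding integral_complex_of_real[symmetric]
    by (simp add: gauss_def[of 0])
  then show ?thesis by (simp only: of_real_eq_iff)
qed

lemma integrable_scaleR_right_iff:
  fixes f :: "'a \<Rightarrow> 'b::{banach, second_countable_topology}"
  assumes "r \<noteq> 0"
  shows "integrable M (\<lambda>x. r *\<^sub>R f x) \<longleftrightarrow> integrable M f"
proof
  assume "integrable M (\<lambda>x. r *\<^sub>R f x)"
  then have "integrable M (\<lambda>x. inverse r *\<^sub>R (r *\<^sub>R f x))" by (rule integrable_scaleR_right)
  then show "integrable M f" using assms by simp
qed simp

lemma integral_lborel_affine: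
  fixes f :: "'a::euclidean_space \<Rightarrow> 'b::{banach, second_countable_topology}"
  assumes [measurable]: "f \<in> borel_measurable borel" and c: "c \<noteq> 0"
  shows "(LINT x|lborel. f x) = \<bar>c\<bar> ^ DIM('a) *\<^sub>R (LINT x|lborel. f (t + c *\<^sub>R x))"
    and "integrable lborel (\<lambda>x. f (t + c *\<^sub>R x)) \<longleftrightarrow> integrable lborel f"
proof -
  show "(LINT x|lborel. f x) = \<bar>c\<bar> ^ DIM('a) *\<^sub>R (LINT x|lborel. f (t + c *\<^sub>R x))"
    by (subst lborel_affine[OF c, of t]) (simp add: integral_density integral_distr)
  show "integrable lborel (\<lambda>x. f (t + c *\<^sub>R x)) \<longleftrightarrow> integrable lborel f"
    using c by (subst (2) lborel_affine[OF c, of t]) (simp add: integrable_density integrable_distr_eq integrable_scaleR_right_iff)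
qed

text \<open>Insert the integral defining \<open>inv_fourier b\<close> and exchange the order; the
  Gaussian factor makes the double integrand integrable although \<open>inv_fourier b\<close> itself
  may fail to be. The integral over \<open>s\<close> is then a Gaussian centred at \<open>y\<close>
  of width \<open>\<epsilon>\<close>, so the right-hand side is a mollification of
  \<open>b\<close>.\<close>

lemma gauss_smoothing:
  fixes b :: "real ^ 'd::finite \<Rightarrow> complex"
  assumes int: "integrable lborel b" and \<epsilon>: "0 < \<epsilon>"
  shows "(LINT s|lborel. inv_fourier b s * iexp (s \<bullet> y) * complex_of_real (gauss (\<epsilon> *\<^sub>R s)))
    = (LINT x|lborel. b (y + \<epsilon> *\<^sub>R x) * complex_of_real (gauss x)) / complex_of_real (sqrt (2 * pi) ^ CARD('d))"
proof -
  have [measurable]: "b \<in> borel_measurable borel" using int by simp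
  let ?F = "\<lambda>s x. b x * iexp (- (s \<bullet> x)) * iexp (s \<bullet> y) * complex_of_real (gauss (\<epsilon> *\<^sub>R s))"
  let ?c = "complex_of_real ((2 * pi) ^ CARD('d))"
  have g\<epsilon>: "integrable lborel (\<lambda>s::real^'d. gauss (\<epsilon> *\<^sub>R s))"
    using integral_lborel_affine(2)[of gauss \<epsilon> 0, THEN iffD2, OF _ _ gauss_integrable] \<epsilon> by simp
  have F: "integrable (lborel \<Otimes>\<^sub>M lborel) (\<lambda>(s, x). ?F s x)"
  proof (rule lborel_pair.Fubini_integrable)
    show "(\<lambda>(s, x). ?F s x) \<in> borel_measurable (lborel \<Otimes>\<^sub>M lborel)" by measurable
    have "(LINT x|lborel. norm (case (s, x) of (s, x) \<Rightarrow> ?F s x)) = (LINT x|lborel. norm (b x)) * gauss (\<epsilon> *\<^sub>R s)" for s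
      using gauss_bounds(1)[of "\<epsilon> *\<^sub>R s"] by (simp add: norm_mult)
    then show "integrable lborel (\<lambda>s. LINT x|lborel. norm (case (s, x) of (s, x) \<Rightarrow> ?F s x))"
      using g\<epsilon> by simp
    have "integrable lborel (\<lambda>x. ?F s x)" for s
      by (intro integrable_mult_left integrable_mult_iexp int) simp
    then show "AE s in lborel. integrable lborel (\<lambda>x. case (s, x) of (s, x) \<Rightarrow> ?F s x)" by simp
  qed
  have "(LINT s|lborel. inv_fourier b s * iexp (s \<bullet> y) * complex_of_real (gauss (\<epsilon> *\<^sub>R s)))
    = (LINT s|lborel. (LINT x|lborel. ?F s x) / ?c)"
    unfolding inv_fourier_def by simp
  also have "\<dots> = (LINT s|lborel. LINT x|lborel. ?F s x) / ?c" by simp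
  also have "(LINT s|lborel. LINT x|lborel. ?F s x) = (LINT x|lborel. LINT s|lborel. ?F s x)"
    using lborel_pair.Fubini_integral[OF F] by simp
  also have "\<dots> = (LINT x|lborel. b x * complex_of_real (sqrt (2 * pi) ^ CARD('d) * inverse \<epsilon> ^ CARD('d) * gauss (inverse \<epsilon> *\<^sub>R (x - y))))"
  proof (intro Bochner_Integration.integral_cong refl)
    fix x
    let ?h = "\<lambda>s. complex_of_real (gauss (\<epsilon> *\<^sub>R s)) * iexp ((y - x) \<bullet> s)"
    have "?F s x = b x * ?h s" for s
      by (simp add: exp_add[symmetric] inner_diff_left inner_commute algebra_simps)
    then have "(LINT s|lborel. ?F s x) = (LINT s|lborel. b x * ?h s)"
      by (intro Bochner_Integration.integral_cong refl)
    also have "\<dots> = b x * (LINT s|lborel. ?h s)"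
      by (rule integral_mult_right_zero)
    \<comment> \<open>Rescaling \<open>s\<close> by \<open>inverse \<epsilon>\<close> moves
      \<open>\<epsilon>\<close> out of the Gaussian and into the frequency, where
      \<open>gauss_fourier\<close> applies.\<close>
    also have "(LINT s|lborel. ?h s) = inverse \<epsilon> ^ CARD('d) *\<^sub>R (LINT s|lborel. ?h (inverse \<epsilon> *\<^sub>R s))"
      using integral_lborel_affine(1)[of ?h "inverse \<epsilon>" 0] \<epsilon> by simp
    also have "(LINT s|lborel. ?h (inverse \<epsilon> *\<^sub>R s)) = (LINT s|lborel. complex_of_real (gauss s) * iexp ((inverse \<epsilon> *\<^sub>R (y - x)) \<bullet> s))"
      using \<epsilon> by simp
    also have "\<dots> = complex_of_real (sqrt (2 * pi) ^ CARD('d) * gauss (inverse \<epsilon> *\<^sub>R (y - x)))"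
      by (rule gauss_fourier(2))
    \<comment> \<open>Evenness of \<open>gauss\<close>; with this sign the substitution
      \<open>y + \<epsilon> *\<^sub>R x\<close> below turns the argument into \<open>x\<close>, and
      its Jacobian cancels the powers of \<open>inverse \<epsilon>\<close>.\<close>
    also have "gauss (inverse \<epsilon> *\<^sub>R (y - x)) = gauss (inverse \<epsilon> *\<^sub>R (x - y))"
      by (simp add: gauss_def inner_diff_left inner_diff_right inner_commute algebra_simps)
    finally show "(LINT s|lborel. ?F s x) = b x * complex_of_real (sqrt (2 * pi) ^ CARD('d) * inverse \<epsilon> ^ CARD('d) * gauss (inverse \<epsilon> *\<^sub>R (x - y)))"
      by (simp add: scaleR_conv_of_real ac_simps)
  qed
  also have "\<dots> = \<epsilon> ^ CARD('d) *\<^sub>R (LINT x|lborel. b (y + \<epsilon> *\<^sub>R x) * complex_of_real (sqrt (2 * pi) ^ CARD('d) * inverse \<epsilon> ^ CARD('d) * gauss x))"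
    using \<epsilon> by (subst integral_lborel_affine(1)[of _ \<epsilon> y]) simp_all
  also have "\<dots> = complex_of_real (sqrt (2 * pi) ^ CARD('d)) * (LINT x|lborel. b (y + \<epsilon> *\<^sub>R x) * complex_of_real (gauss x))"
  proof -
    have "\<epsilon> ^ CARD('d) *\<^sub>R (LINT x|lborel. b (y + \<epsilon> *\<^sub>R x) * complex_of_real (sqrt (2 * pi) ^ CARD('d) * inverse \<epsilon> ^ CARD('d) * gauss x))
      = (LINT x|lborel. \<epsilon> ^ CARD('d) *\<^sub>R (b (y + \<epsilon> *\<^sub>R x) * complex_of_real (sqrt (2 * pi) ^ CARD('d) * inverse \<epsilon> ^ CARD('d) * gauss x)))"
      by simp
    also have "\<dots> = (LINT x|lborel. complex_of_real (sqrt (2 * pi) ^ CARD('d)) * (b (y + \<epsilon> *\<^sub>R x) * complex_of_real (gauss x)))"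
    proof (intro Bochner_Integration.integral_cong refl)
      fix x
      have "complex_of_real (\<epsilon> ^ CARD('d)) * complex_of_real (inverse \<epsilon> ^ CARD('d)) = 1"
        using \<epsilon> unfolding of_real_mult[symmetric] by (simp add: power_inverse)
      then have "complex_of_real (\<epsilon> ^ CARD('d)) * (b (y + \<epsilon> *\<^sub>R x) * (complex_of_real (sqrt (2 * pi) ^ CARD('d)) * complex_of_real (inverse \<epsilon> ^ CARD('d)) * complex_of_real (gauss x)))
        = complex_of_real (sqrt (2 * pi) ^ CARD('d)) * (b (y + \<epsilon> *\<^sub>R x) * complex_of_real (gauss x))"
        by algebra
      then show "\<epsilon> ^ CARD('d) *\<^sub>R (b (y + \<epsilon> *\<^sub>R x) * complex_of_real (sqrt (2 * pi) ^ CARD('d) * inverse \<epsilon> ^ CARD('d) * gauss x))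
        = complex_of_real (sqrt (2 * pi) ^ CARD('d)) * (b (y + \<epsilon> *\<^sub>R x) * complex_of_real (gauss x))"
        by (simp only: scaleR_conv_of_real of_real_mult)
    qed
    finally show ?thesis by simp
  qed
  \<comment> \<open>The constant \<open>(2 * pi) ^ CARD('d)\<close> from \<open>inv_fourier\<close>
    is the square of the Gaussian one, so one factor survives in the denominator.\<close>
  also have "complex_of_real (sqrt (2 * pi) ^ CARD('d)) * z / ?c = z / complex_of_real (sqrt (2 * pi) ^ CARD('d))" for z
  proof -
    have "?c = complex_of_real (sqrt (2 * pi) ^ CARD('d)) * complex_of_real (sqrt (2 * pi) ^ CARD('d))"
      unfolding of_real_mult[symmetric] power_mult_distrib[symmetric] by simp
    moreover have "complex_of_real (sqrt (2 * pi) ^ CARD('d)) \<noteq> 0" by simp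
    ultimately show ?thesis by (metis mult_divide_mult_cancel_left)
  qed
  finally show ?thesis .
qed

section \<open>Fourier inversion on the Schwartz space\<close>

lemma tendsto_gauss_scale:
  fixes s :: "real ^ 'd::finite"
  shows "(\<lambda>n. gauss (inverse (real (Suc n)) *\<^sub>R s)) \<longlonglongrightarrow> 1"
proof -
  have "(\<lambda>n. gauss (inverse (real (Suc n)) *\<^sub>R s)) \<longlonglongrightarrow> gauss (0 *\<^sub>R s)"
    unfolding gauss_def by (intro tendsto_intros LIMSEQ_inverse_real_of_nat) simp
  then show ?thesis by (simp add: gauss_def)
qed

text \<open>Let the width in \<open>gauss_smoothing\<close> tend to 0. The left side is dominated by
  the integrable \<open>norm (inv_fourier \<psi> s)\<close>. The right side is dominated by a
  multiple of \<open>gauss\<close>, and continuity of \<open>\<psi>\<close> at \<open>y\<close>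
  produces \<open>\<psi> y\<close> times the mass of the Gaussian.\<close>

lemma fourier_inv_fourier:
  fixes \<psi> :: "'d::finite test_fun"
  assumes \<psi>: "\<psi> \<in> Schwartz"
  shows "fourier (inv_fourier \<psi>) y = \<psi> y"
proof -
  have [measurable]: "\<psi> \<in> borel_measurable borel"
    by (intro borel_measurable_continuous_onI Schwartz_continuous \<psi>)
  define \<epsilon> where "\<epsilon> n = inverse (real (Suc n))" for n
  have \<epsilon>: "0 < \<epsilon> n" "\<epsilon> \<longlonglongrightarrow> 0" for n
    using LIMSEQ_inverse_real_of_nat by (simp_all add: \<epsilon>_def[abs_def])
  obtain C where C: "0 \<le> C" "\<And>x. norm (\<psi> x) \<le> C * inverse (jap x)"
    using Schwartz_decay[OF \<psi>] by blast
  have C': "norm (\<psi> x) \<le> C" for x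
    using C(2)[of x] mult_left_mono[OF _ C(1), of "inverse (jap x)" 1] jap_ge_1[of x]
    by (simp add: inverse_le_1_iff)
  have "(\<lambda>n. LINT s|lborel. inv_fourier \<psi> s * iexp (s \<bullet> y) * complex_of_real (gauss (\<epsilon> n *\<^sub>R s)))
    \<longlonglongrightarrow> (LINT s|lborel. inv_fourier \<psi> s * iexp (s \<bullet> y))"
  proof (rule integral_dominated_convergence[where w = "\<lambda>s. norm (inv_fourier \<psi> s)"])
    show "integrable lborel (\<lambda>s. norm (inv_fourier \<psi> s))"
      using inv_fourier_Schwartz_integrable[OF \<psi>] by simp
    show "AE s in lborel. (\<lambda>n. inv_fourier \<psi> s * iexp (s \<bullet> y) * complex_of_real (gauss (\<epsilon> n *\<^sub>R s)))
      \<longlonglongrightarrow> inv_fourier \<psi> s * iexp (s \<bullet> y)"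
    proof (rule AE_I2)
      fix s
      have "(\<lambda>n. inv_fourier \<psi> s * iexp (s \<bullet> y) * complex_of_real (gauss (\<epsilon> n *\<^sub>R s)))
        \<longlonglongrightarrow> inv_fourier \<psi> s * iexp (s \<bullet> y) * complex_of_real 1"
        unfolding \<epsilon>_def by (intro tendsto_intros tendsto_gauss_scale)
      then show "(\<lambda>n. inv_fourier \<psi> s * iexp (s \<bullet> y) * complex_of_real (gauss (\<epsilon> n *\<^sub>R s)))
        \<longlonglongrightarrow> inv_fourier \<psi> s * iexp (s \<bullet> y)" by simp
    qed
    show "AE s in lborel. norm (inv_fourier \<psi> s * iexp (s \<bullet> y) * complex_of_real (gauss (\<epsilon> n *\<^sub>R s)))
      \<le> norm (inv_fourier \<psi> s)" for n
      by (intro AE_I2) (simp add: norm_mult mult_left_le gauss_bounds)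
  qed measurable
  then have lim1: "(\<lambda>n. (LINT x|lborel. \<psi> (y + \<epsilon> n *\<^sub>R x) * complex_of_real (gauss x)) / complex_of_real (sqrt (2 * pi) ^ CARD('d)))
    \<longlonglongrightarrow> (LINT s|lborel. inv_fourier \<psi> s * iexp (s \<bullet> y))"
    by (simp only: gauss_smoothing[OF Schwartz_integrable[OF \<psi>] \<epsilon>(1)])
  have lim2: "(\<lambda>n. LINT x|lborel. \<psi> (y + \<epsilon> n *\<^sub>R x) * complex_of_real (gauss x))
    \<longlonglongrightarrow> (LINT x::real^'d|lborel. \<psi> y * complex_of_real (gauss x))"
  proof (rule integral_dominated_convergence[where w = "\<lambda>x::real^'d. C * gauss x"])
    show "integrable lborel (\<lambda>x::real^'d. C * gauss x)" by (intro integrable_mult_right gauss_integrable)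
    have cont: "isCont \<psi> y" using Schwartz_continuous[OF \<psi>, of UNIV] continuous_on_eq_continuous_at by blast
    have "(\<lambda>n. y + \<epsilon> n *\<^sub>R x) \<longlonglongrightarrow> y" for x
      using tendsto_add[OF tendsto_const[of y] tendsto_scaleR[OF \<epsilon>(2) tendsto_const[of x]]] by simp
    then show "AE x in lborel. (\<lambda>n. \<psi> (y + \<epsilon> n *\<^sub>R x) * complex_of_real (gauss x)) \<longlonglongrightarrow> \<psi> y * complex_of_real (gauss x)"
      by (intro AE_I2 tendsto_mult tendsto_const isCont_tendsto_compose[OF cont])
    show "AE x in lborel. norm (\<psi> (y + \<epsilon> n *\<^sub>R x) * complex_of_real (gauss x)) \<le> C * gauss x" for n
      by (intro AE_I2) (simp add: norm_mult mult_right_mono C' less_imp_le gauss_bounds)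
  qed measurable
  have "(LINT s|lborel. inv_fourier \<psi> s * iexp (s \<bullet> y))
    = (LINT x::real^'d|lborel. \<psi> y * complex_of_real (gauss x)) / complex_of_real (sqrt (2 * pi) ^ CARD('d))"
    by (rule LIMSEQ_unique[OF lim1 tendsto_divide[OF lim2 tendsto_const]]) simp
  also have "\<dots> = \<psi> y"
  proof -
    have "(LINT x::real^'d|lborel. \<psi> y * complex_of_real (gauss x))
      = \<psi> y * complex_of_real (sqrt (2 * pi) ^ CARD('d))"
      by (simp only: integral_mult_right_zero integral_complex_of_real gauss_integral)
    then show ?thesis by (simp only:) simp
  qed
  finally show ?thesis by (simp add: fourier_def)
qed

section \<open>Uniqueness for the Fourier transform of integrable functions\<close>

text \<open>Smoothing gives \<open>\<integral> b(y + \<epsilon>x) gauss(x) dx = 0\<close> for all \<open>y\<close>; integrate over \<open>y\<close> in the box and let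
  \<open>\<epsilon> \<rightarrow> 0\<close>.\<close>

lemma set_integral_box_eq_0:
  fixes b :: "real ^ 'd::finite \<Rightarrow> complex"
  assumes int: "integrable lborel b" and 0: "\<And>s. inv_fourier b s = 0"
  shows "(LINT y:box l u|lborel. b y) = 0"
proof -
  have [measurable]: "b \<in> borel_measurable borel" using int by simp
  define \<epsilon> where "\<epsilon> n = inverse (real (Suc n))" for n
  have \<epsilon>: "0 < \<epsilon> n" "\<epsilon> \<longlonglongrightarrow> 0" for n
    using LIMSEQ_inverse_real_of_nat by (simp_all add: \<epsilon>_def[abs_def])
  \<comment> \<open>The shift is moved from \<open>b\<close> to the indicator of the box. The
    function \<open>b\<close> need not be continuous, so
    \<open>b (y + \<epsilon> n *\<^sub>R x)\<close> may fail to converge pointwise, while the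
    shifted indicators converge off the boundary of the box.\<close>
  define J where "J n x = (LINT y|lborel. indicat_real (box l u) (y - \<epsilon> n *\<^sub>R x) *\<^sub>R b y)" for n x
  have [measurable]: "J n \<in> borel_measurable borel" for n unfolding J_def[abs_def] by measurable
  have zero: "(LINT x|lborel. gauss x *\<^sub>R J n x) = 0" for n
  proof -
    let ?F = "\<lambda>x y. indicat_real (box l u) y *\<^sub>R (b (y + \<epsilon> n *\<^sub>R x) * complex_of_real (gauss x))"
    have bt: "integrable lborel (\<lambda>y. b (y + c))" for c
      using integral_lborel_translate(2)[of b c] int by simp
    have F: "integrable (lborel \<Otimes>\<^sub>M lborel) (\<lambda>(x, y). ?F x y)"
    proof (rule lborel_pair.Fubini_integrable)
      show "(\<lambda>(x, y). ?F x y) \<in> borel_measurable (lborel \<Otimes>\<^sub>M lborel)" by measurable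
      show "integrable lborel (\<lambda>x. LINT y|lborel. norm (case (x, y) of (x, y) \<Rightarrow> ?F x y))"
      proof (rule Bochner_Integration.integrable_bound)
        show "integrable lborel (\<lambda>x::real^'d. (LINT y|lborel. norm (b y)) * gauss x)"
          by (intro integrable_mult_right gauss_integrable)
        show "AE x in lborel. norm (LINT y|lborel. norm (case (x, y) of (x, y) \<Rightarrow> ?F x y)) \<le> norm ((LINT y|lborel. norm (b y)) * gauss x)"
        proof (rule AE_I2)
          fix x
          have "(LINT y|lborel. norm (?F x y)) \<le> (LINT y|lborel. norm (b (y + \<epsilon> n *\<^sub>R x)) * gauss x)"
            using bt[of "\<epsilon> n *\<^sub>R x"] gauss_bounds(1)[of x]
            by (intro integral_mono' integrable_mult_left) (auto simp: norm_mult indicator_def)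
          also have "\<dots> = (LINT y|lborel. norm (b y)) * gauss x"
            by (simp add: integral_lborel_translate(1)[of "\<lambda>y. norm (b y)"])
          finally show "norm (LINT y|lborel. norm (case (x, y) of (x, y) \<Rightarrow> ?F x y)) \<le> norm ((LINT y|lborel. norm (b y)) * gauss x)"
            by (simp add: abs_of_nonneg integral_nonneg_AE)
        qed
      qed measurable
      show "AE x in lborel. integrable lborel (\<lambda>y. case (x, y) of (x, y) \<Rightarrow> ?F x y)"
        using bt by (auto intro!: AE_I2 integrable_mult_indicator[where 'a="real^'d"])
    qed
    have "(LINT y|lborel. ?F x y) = gauss x *\<^sub>R J n x" for x
    proof -
      have "(LINT y|lborel. ?F x y) = (LINT y|lborel. gauss x *\<^sub>R (indicat_real (box l u) ((y + \<epsilon> n *\<^sub>R x) - \<epsilon> n *\<^sub>R x) *\<^sub>R b (y + \<epsilon> n *\<^sub>R x)))"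
        by (simp add: scaleR_conv_of_real ac_simps)
      also have "\<dots> = gauss x *\<^sub>R J n x"
        unfolding J_def by (subst integral_lborel_translate(1)[of "\<lambda>y. gauss x *\<^sub>R (indicat_real (box l u) (y - \<epsilon> n *\<^sub>R x) *\<^sub>R b y)"])
          (simp_all del: scaleR_scaleR)
      finally show ?thesis .
    qed
    then have "(LINT x|lborel. gauss x *\<^sub>R J n x) = (LINT y|lborel. LINT x|lborel. ?F x y)"
      using lborel_pair.Fubini_integral[OF F] by simp
    also have "\<dots> = (LINT y|lborel. indicat_real (box l u) y *\<^sub>R (LINT x|lborel. (b (y + \<epsilon> n *\<^sub>R x) * complex_of_real (gauss x))))"
      by simp
    also have "\<dots> = 0"
    proof -
      have "(LINT x|lborel. b (y + \<epsilon> n *\<^sub>R x) * complex_of_real (gauss x)) = 0" for y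
        using gauss_smoothing[OF int \<epsilon>(1)[of n], of y] by (simp add: 0)
      then show ?thesis by simp
    qed
    finally show ?thesis .
  qed
  \<comment> \<open>The boundary is the only place where the shifted indicators may fail to
    converge.\<close>
  have null: "AE y in lborel. y \<notin> cbox l u - box l u"
  proof (rule AE_not_in)
    have "cbox l u - box l u \<in> null_sets lebesgue"
      using negligible_frontier_interval negligible_iff_null_sets by blast
    then show "cbox l u - box l u \<in> null_sets lborel"
      by (subst (asm) null_sets_completion_iff) auto
  qed
  have J_lim: "(\<lambda>n. J n x) \<longlonglongrightarrow> (LINT y:box l u|lborel. b y)" for x
    unfolding J_def set_lebesgue_integral_def
  proof (rule integral_dominated_convergence[where w = "\<lambda>y. norm (b y)"])
    show "AE y in lborel. (\<lambda>n. indicat_real (box l u) (y - \<epsilon> n *\<^sub>R x) *\<^sub>R b y) \<longlonglongrightarrow> indicat_real (box l u) y *\<^sub>R b y"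
      using null
    proof eventually_elim
      case (elim y)
      have lim: "(\<lambda>n. y - \<epsilon> n *\<^sub>R x) \<longlonglongrightarrow> y"
        using tendsto_diff[OF tendsto_const[of y] tendsto_scaleR[OF \<epsilon>(2) tendsto_const[of x]]] by simp
      have "\<forall>\<^sub>F n in sequentially. indicat_real (box l u) (y - \<epsilon> n *\<^sub>R x) = indicat_real (box l u) y"
      proof (cases "y \<in> box l u")
        case True
        from topological_tendstoD[OF lim open_box this] show ?thesis
          by eventually_elim (use True in simp)
      next
        case False
        with elim have "y \<in> - cbox l u" by auto
        from topological_tendstoD[OF lim open_Compl[OF closed_cbox] this] show ?thesis
          by eventually_elim (use False box_subset_cbox[of l u] in \<open>auto simp: indicator_def\<close>)
      qed
      then show ?case
        by (intro tendsto_scaleR tendsto_const tendsto_eventually)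
    qed
    show "AE y in lborel. norm (indicat_real (box l u) (y - \<epsilon> n *\<^sub>R x) *\<^sub>R b y) \<le> norm (b y)" for n
      by (auto simp: indicator_def)
    show "integrable lborel (\<lambda>y. norm (b y))" using int by simp
  qed measurable
  \<comment> \<open>A second passage to the limit, now in the integral over \<open>x\<close>. Each
    term is 0 by \<open>zero\<close>, so the limit, a positive multiple of the integral of
    \<open>b\<close> over the box, is 0 as well.\<close>
  have "(\<lambda>n. LINT x|lborel. gauss x *\<^sub>R J n x) \<longlonglongrightarrow> (LINT x::real^'d|lborel. gauss x *\<^sub>R (LINT y:box l u|lborel. b y))"
  proof (rule integral_dominated_convergence[where w = "\<lambda>x. gauss x * (LINT y|lborel. norm (b y))"])
    show "AE x::real^'d in lborel. (\<lambda>n. gauss x *\<^sub>R J n x) \<longlonglongrightarrow> gauss x *\<^sub>R (LINT y:box l u|lborel. b y)"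
      by (intro AE_I2 tendsto_scaleR tendsto_const J_lim)
    show "integrable lborel (\<lambda>x::real^'d. gauss x * (LINT y|lborel. norm (b y)))"
      by (intro integrable_mult_left gauss_integrable)
    show "AE x in lborel. norm (gauss x *\<^sub>R J n x) \<le> gauss x * (LINT y|lborel. norm (b y))" for n
    proof (rule AE_I2)
      fix x
      have "norm (J n x) \<le> (LINT y|lborel. norm (indicat_real (box l u) (y - \<epsilon> n *\<^sub>R x) *\<^sub>R b y))"
        unfolding J_def by (rule integral_norm_bound)
      also have "\<dots> \<le> (LINT y|lborel. norm (b y))"
        using int by (intro integral_mono') (auto simp: indicator_def)
      finally show "norm (gauss x *\<^sub>R J n x) \<le> gauss x * (LINT y|lborel. norm (b y))"
        using gauss_bounds(1)[of x] by (auto simp: abs_of_pos intro!: mult_left_mono)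
    qed
  qed measurable
  then have "(LINT x::real^'d|lborel. gauss x *\<^sub>R (LINT y:box l u|lborel. b y)) = 0"
    unfolding zero by (simp add: LIMSEQ_const_iff)
  also have "(LINT x::real^'d|lborel. gauss x *\<^sub>R (LINT y:box l u|lborel. b y))
    = sqrt (2 * pi) ^ CARD('d) *\<^sub>R (LINT y:box l u|lborel. b y)"
    by (subst integral_scaleR_left) (simp_all add: gauss_integral gauss_integrable)
  finally show ?thesis by simp
qed

text \<open>A Dynkin argument: open boxes are stable under intersection and generate the Borel sets,
  and the sets over which \<open>b\<close> integrates to 0 are closed under complements and
  countable disjoint unions.\<close>

lemma inv_fourier_eq_0_imp_AE_eq_0:
  fixes b :: "real ^ 'd::finite \<Rightarrow> complex"
  assumes int: "integrable lborel b" and 0: "\<And>s. inv_fourier b s = 0"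
  shows "AE x in lborel. b x = 0"
proof (rule sigma_finite_measure.density_zero[OF sigma_finite_lborel int])
  fix A :: "(real ^ 'd) set" assume "A \<in> sets lborel"
  \<comment> \<open>The complement step needs the integral over the whole space, which is not a box;
    it is the value of the transform at frequency 0 up to a constant.\<close>
  have total: "(LINT x|lborel. b x) = 0"
    using 0[of 0] by (simp add: inv_fourier_def)
  have si: "set_integrable lborel A b" if "A \<in> sets lborel" for A
    unfolding set_integrable_def using that int by (intro integrable_mult_indicator)
  let ?G = "range (\<lambda>(a, b). box a b :: (real ^ 'd) set)"
  have "A \<in> sigma_sets UNIV ?G"
    using \<open>A \<in> sets lborel\<close> unfolding sets_lborel borel_eq_box by (simp add: sets_measure_of)
  have "Int_stable ?G"
    by (auto simp: Int_stable_def box_Int_box)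
  moreover have "?G \<subseteq> Pow UNIV" by simp
  moreover note \<open>A \<in> sigma_sets UNIV ?G\<close>
  ultimately show "(LINT x:A|lborel. b x) = 0"
  proof (induction rule: sigma_sets_induct_disjoint)
    case (basic A)
    then show ?case using set_integral_box_eq_0[OF assms] by auto
  next
    case empty
    show ?case by (simp add: set_lebesgue_integral_def)
  next
    case (compl A)
    have A: "A \<in> sets lborel" using compl.hyps by (simp add: borel_eq_box sets_measure_of)
    have "(LINT x:UNIV|lborel. b x) = (LINT x:A|lborel. b x) + (LINT x:UNIV - A|lborel. b x)"
      using A by (subst set_integral_Un[symmetric]) (auto intro!: si simp: Un_absorb1)
    then show ?case using compl.IH total by (simp add: set_lebesgue_integral_def)
  next
    case (union A)
    have A: "A i \<in> sets lborel" for i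
      using union.hyps by (auto simp: borel_eq_box sets_measure_of)
    have "(LINT x:(\<Union>i. A i)|lborel. b x) = (\<Sum>i. (LINT x:(A i)|lborel. b x))"
      using A union.hyps(1) by (intro lebesgue_integral_countable_add si) (auto simp: disjoint_family_on_def)
    then show ?case using union.IH by simp
  qed
qed

section \<open>Generalized densities act by integration\<close>

lemma borel_measurable_vec_nth [measurable (raw)]:
  fixes f :: "'a \<Rightarrow> real ^ 'd::finite"
  assumes "f \<in> borel_measurable M"
  shows "(\<lambda>x. f x $ i) \<in> borel_measurable M"
  using assms by (rule measurable_compose) (intro borel_measurable_continuous_onI continuous_intros)

lemma jap_ge_prod: "(\<Prod>i\<in>I. 1 + (x $ i)\<^sup>2) \<le> jap x"
proof -
  have "jap x = (\<Prod>i\<in>I. 1 + (x $ i)\<^sup>2) * (\<Prod>i\<in>UNIV - I. 1 + (x $ i)\<^sup>2)"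
    unfolding jap_def by (subst mult.commute, rule prod.subset_diff) auto
  moreover have "1 \<le> (\<Prod>i\<in>UNIV - I. 1 + (x $ i)\<^sup>2)" by (rule prod_ge_1) simp
  moreover have "0 \<le> (\<Prod>i\<in>I. 1 + (x $ i)\<^sup>2)" by (rule prod_nonneg) simp
  ultimately show ?thesis by (simp add: mult_le_cancel_left1)
qed

text \<open>Decay in the coordinates of \<open>I\<close>, uniformly in the others. One coordinate
  serves for integrals along lines, a larger set for integrals over some of the coordinates with the
  rest frozen.\<close>

lemma Schwartz_decay_prod:
  assumes "\<psi> \<in> Schwartz"
  obtains C where "0 \<le> C" "\<And>x. norm (\<psi> x) \<le> C * (\<Prod>i\<in>I. inverse (1 + (x $ i)\<^sup>2))"
proof -
  obtain C where C: "0 \<le> C" "\<And>x. norm (\<psi> x) \<le> C * inverse (jap x)"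
    using Schwartz_decay[OF assms] by blast
  have "inverse (jap x) \<le> (\<Prod>i\<in>I. inverse (1 + (x $ i)\<^sup>2))" for x
  proof -
    have "0 < (\<Prod>i\<in>I. 1 + (x $ i)\<^sup>2)" by (rule prod_pos) (simp add: add_pos_nonneg)
    then show ?thesis
      using le_imp_inverse_le[OF jap_ge_prod[where I=I and x=x]]
      by (simp add: prod_inversef[symmetric] comp_def)
  qed
  with C(1) have "C * inverse (jap x) \<le> C * (\<Prod>i\<in>I. inverse (1 + (x $ i)\<^sup>2))" for x
    by (rule mult_left_mono[rotated])
  with C that show thesis by (meson order_trans)
qed

lemma Schwartz_line:
  assumes "\<psi> \<in> Schwartz"
  shows "integrable lborel (\<lambda>t. \<psi> (z + t *\<^sub>R axis j 1))"
    and "((\<lambda>t. \<psi> (z + t *\<^sub>R axis j 1)) \<longlongrightarrow> 0) at_top"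
proof -
  obtain C where C: "\<And>x. norm (\<psi> x) \<le> C * inverse (1 + (x $ j)\<^sup>2)"
    using Schwartz_decay_prod[OF assms, of "{j}"] by auto
  have bound: "norm (\<psi> (z + t *\<^sub>R axis j 1)) \<le> C * inverse (1 + (z $ j + t)\<^sup>2)" for t
    using C[of "z + t *\<^sub>R axis j 1"] by simp
  have meas: "(\<lambda>t. \<psi> (z + t *\<^sub>R axis j 1)) \<in> borel_measurable borel"
    by (intro borel_measurable_continuous_onI continuous_on_compose2[OF Schwartz_continuous[OF assms, of UNIV]] continuous_intros) auto
  have "integrable lborel (\<lambda>t. C * inverse (1 + (z $ j + t)\<^sup>2))"
    using lborel_integrable_real_affine[OF integrable_inverse_one_plus_square, of 1 "z $ j"]
    by (intro integrable_mult_right) simp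
  then show "integrable lborel (\<lambda>t. \<psi> (z + t *\<^sub>R axis j 1))"
    by (rule Bochner_Integration.integrable_bound)
       (use meas in \<open>auto intro!: AE_I2 order_trans[OF bound] abs_ge_self\<close>)
  have "filterlim (\<lambda>t. 1 + (z $ j + t)\<^sup>2) at_top at_top"
  proof (rule filterlim_at_top_mono)
    show "filterlim (\<lambda>t. z $ j + t) at_top at_top"
      by (rule filterlim_tendsto_add_at_top[OF tendsto_const filterlim_ident])
    have "u \<le> 1 + u\<^sup>2" for u :: real
      using sum_squares_bound[of u 1] by (smt (verit) power2_eq_square mult.right_neutral one_power2 zero_le_power2)
    then show "\<forall>\<^sub>F t in at_top. z $ j + t \<le> 1 + (z $ j + t)\<^sup>2" by simp
  qed
  then have "((\<lambda>t. C * inverse (1 + (z $ j + t)\<^sup>2)) \<longlongrightarrow> 0) at_top"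
    by (intro tendsto_mult_right_zero tendsto_inverse_0_at_top)
  then show "((\<lambda>t. \<psi> (z + t *\<^sub>R axis j 1)) \<longlongrightarrow> 0) at_top"
    by (rule Lim_null_comparison[rotated]) (use bound in simp)
qed

text \<open>The fundamental theorem of calculus on a bounded interval, with the upper boundary term
  vanishing in the limit. In the application \<open>z\<close> has \<open>j\<close>-th coordinate
  \<open>a\<close>, so \<open>z + (t - a) *\<^sub>R axis j 1\<close> replaces that coordinate by
  \<open>t\<close>.\<close>

lemma integral_half_line_partial:
  assumes \<psi>: "\<psi> \<in> Schwartz"
  shows "(LINT t|lborel. indicat_real {a..} t *\<^sub>R partial j \<psi> (z + (t - a) *\<^sub>R axis j 1)) = - \<psi> z"
proof -
  let ?f = "\<lambda>t. partial j \<psi> (z + t *\<^sub>R axis j 1)"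
  let ?I = "LINT t|lborel. indicat_real {0..} t *\<^sub>R ?f t"
  note S = Schwartz_line[OF partial_Schwartz[OF \<psi>, of j], where z=z and j=j]
  have cont: "continuous_on A ?f" for A
    by (intro continuous_on_compose2[OF Schwartz_continuous[OF partial_Schwartz[OF \<psi>], of UNIV]] continuous_intros) auto
  have int: "integrable lborel (\<lambda>t. indicat_real {0..} t *\<^sub>R ?f t)"
    by (intro integrable_mult_indicator S) simp
  have "((\<lambda>y. LINT t|lborel. indicat_real {..y} t *\<^sub>R (indicat_real {0..} t *\<^sub>R ?f t)) \<longlongrightarrow> ?I) at_top"
    by (rule tendsto_integral_at_top[OF _ int]) simp
  moreover have "\<forall>\<^sub>F y in at_top. (LINT t|lborel. indicat_real {..y} t *\<^sub>R (indicat_real {0..} t *\<^sub>R ?f t))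
    = \<psi> (z + y *\<^sub>R axis j 1) - \<psi> z"
    using eventually_ge_at_top[of 0]
  proof eventually_elim
    case (elim y)
    have "(LINT t|lborel. indicat_real {..y} t *\<^sub>R (indicat_real {0..} t *\<^sub>R ?f t)) = (LINT t|lborel. indicat_real {0..y} t *\<^sub>R ?f t)"
      by (intro Bochner_Integration.integral_cong refl) (auto simp: indicator_def)
    also have "\<dots> = \<psi> (z + y *\<^sub>R axis j 1) - \<psi> (z + 0 *\<^sub>R axis j 1)"
      by (rule integral_FTC_atLeastAtMost[OF elim _ cont])
         (rule has_vector_derivative_at_within[OF has_vector_derivative_partial[OF
            Schwartz_differentiable[OF \<psi>, of "[]", unfolded partials_Nil]]])
    finally show ?case by simp
  qed
  ultimately have "((\<lambda>y. \<psi> (z + y *\<^sub>R axis j 1) - \<psi> z) \<longlongrightarrow> ?I) at_top"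
    by (rule Lim_transform_eventually)
  moreover have "((\<lambda>y. \<psi> (z + y *\<^sub>R axis j 1) - \<psi> z) \<longlongrightarrow> 0 - \<psi> z) at_top"
    by (intro tendsto_diff tendsto_const Schwartz_line[OF \<psi>])
  ultimately have "?I = - \<psi> z"
    using tendsto_unique[OF trivial_limit_at_top_linorder] by fastforce
  moreover have "(LINT t|lborel. indicat_real {a..} t *\<^sub>R ?f (t - a)) = ?I"
  proof -
    have "indicat_real {a..} (a + t) = indicat_real {0..} t" for t by (simp add: indicator_def)
    then show ?thesis
      using lborel_integral_real_affine[of 1 "\<lambda>t. indicat_real {a..} t *\<^sub>R ?f (t - a)" a] by simp
  qed
  ultimately show ?thesis by simp
qed

text \<open>The outermost derivative is integrated out first, so that the induction follows the list and
  never has to commute derivatives.\<close>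

lemma integral_orthant_partials:
  fixes \<psi> :: "'d::finite test_fun" and y :: "real ^ 'd"
  assumes "\<psi> \<in> Schwartz" "distinct l"
  shows "(LINT h|(\<Pi>\<^sub>M i\<in>set l. lborel). (\<Prod>i\<in>set l. indicat_real {y $ i..} (h i)) *\<^sub>R
      partials l \<psi> (\<chi> i. if i \<in> set l then h i else y $ i)) = (- 1) ^ length l * \<psi> y"
  using \<open>distinct l\<close>
proof (induction l)
  case Nil
  \<comment> \<open>The product measure over no coordinates is a point mass, and the vector reduces
    to \<open>y\<close>.\<close>
  then show ?case by (simp add: PiM_empty lebesgue_integral_count_space_finite)
next
  case (Cons j l)
  let ?vec = "\<lambda>I h. (\<chi> i. if i \<in> I then h i else y $ i) :: real ^ 'd"
  let ?P = "\<lambda>I h. \<Prod>i\<in>I. indicat_real {y $ i..} (h i)"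
  let ?G = "\<lambda>h. ?P (set (j # l)) h *\<^sub>R partials (j # l) \<psi> (?vec (set (j # l)) h)"
  have j: "j \<notin> set l" and IH: "(LINT h|(\<Pi>\<^sub>M i\<in>set l. lborel). ?P (set l) h *\<^sub>R partials l \<psi> (?vec (set l) h)) = (- 1) ^ length l * \<psi> y"
    using Cons by auto
  have \<eta>: "partials l \<psi> \<in> Schwartz" and \<eta>': "partials (j # l) \<psi> \<in> Schwartz"
    by (intro partials_Schwartz assms)+
  have vec_meas: "?vec I \<in> borel_measurable (\<Pi>\<^sub>M i\<in>I. lborel)" for I
  proof -
    have "(\<lambda>h. if i \<in> I then h i else y $ i) \<in> borel_measurable (\<Pi>\<^sub>M i\<in>I. lborel)" for i
      by (cases "i \<in> I") (auto intro: measurable_component_singleton[of _ I "\<lambda>_. lborel", simplified])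
    then show ?thesis
      unfolding borel_measurable_euclidean_space[of "?vec I"] by (auto simp: Basis_vec_def inner_axis)
  qed
  have P: "0 \<le> ?P I h" "?P I h \<le> 1" for I h
    by (auto intro!: prod_nonneg prod_le_1 simp: indicator_def)
  have int: "integrable (\<Pi>\<^sub>M i\<in>insert j (set l). lborel) ?G"
  proof -
    \<comment> \<open>Only the coordinates in \<open>j # l\<close> are integrated, so the majorant
      must decay in exactly these.\<close>
    obtain C where C: "0 \<le> C" "\<And>x. norm (partials (j # l) \<psi> x) \<le> C * (\<Prod>i\<in>set (j # l). inverse (1 + (x $ i)\<^sup>2))"
      using Schwartz_decay_prod[OF \<eta>'] by metis
    show ?thesis
    proof (rule Bochner_Integration.integrable_bound)
      show "integrable (\<Pi>\<^sub>M i\<in>insert j (set l). lborel) (\<lambda>h. C * (\<Prod>i\<in>set (j # l). inverse (1 + (h i)\<^sup>2)))"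
        using lborel_prod.product_integrable_prod[of "set (j # l)" "\<lambda>_ t. inverse (1 + t\<^sup>2)"] integrable_inverse_one_plus_square
        by (intro integrable_mult_right) simp
      show "?G \<in> borel_measurable (\<Pi>\<^sub>M i\<in>insert j (set l). lborel)"
        using Schwartz_measurable[OF \<eta>' vec_meas[of "set (j # l)"]]
        by (intro borel_measurable_scaleR borel_measurable_prod) auto
      have "norm (?G h) \<le> C * (\<Prod>i\<in>set (j # l). inverse (1 + (h i)\<^sup>2))" for h
      proof -
        have "norm (?G h) \<le> norm (partials (j # l) \<psi> (?vec (set (j # l)) h))"
          unfolding norm_scaleR using P[of h "set (j # l)"] by (intro mult_left_le_one_le) auto
        also have "\<dots> \<le> C * (\<Prod>i\<in>set (j # l). inverse (1 + (?vec (set (j # l)) h $ i)\<^sup>2))" by (rule C(2))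
        also have "\<dots> = C * (\<Prod>i\<in>set (j # l). inverse (1 + (h i)\<^sup>2))"
          by (intro arg_cong2[where f="(*)"] prod.cong) auto
        finally show ?thesis .
      qed
      then show "AE h in \<Pi>\<^sub>M i\<in>insert j (set l). lborel. norm (?G h) \<le> norm (C * (\<Prod>i\<in>set (j # l). inverse (1 + (h i)\<^sup>2)))"
        unfolding real_norm_def by (intro AE_I2) (rule order_trans[OF _ abs_ge_self])
    qed
  qed
  have "(LINT h|(\<Pi>\<^sub>M i\<in>set (j # l). lborel). ?G h) = (LINT h|(\<Pi>\<^sub>M i\<in>set l. lborel). LINT t|lborel. ?G (h(j := t)))"
    using lborel_prod.product_integral_insert[OF _ j int] by simp
  also have "\<dots> = (LINT h|(\<Pi>\<^sub>M i\<in>set l. lborel). - (?P (set l) h *\<^sub>R partials l \<psi> (?vec (set l) h)))"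
  proof (intro Bochner_Integration.integral_cong refl)
    fix h :: "'d \<Rightarrow> real"
    \<comment> \<open>Since \<open>j\<close> is not in \<open>l\<close>, the \<open>j\<close>-th
      coordinate of \<open>?vec (set l) h\<close> still equals \<open>y $ j\<close>, the endpoint of
      the half line.\<close>
    have vec: "?vec (set (j # l)) (h(j := t)) = ?vec (set l) h + (t - y $ j) *\<^sub>R axis j 1" for t
      using j by (auto simp: vec_eq_iff axis_def)
    have "?P (set (j # l)) (h(j := t)) = indicat_real {y $ j..} t * ?P (set l) h" for t
    proof -
      have "?P (set l) (h(j := t)) = ?P (set l) h" using j by (intro prod.cong) auto
      then show ?thesis using j by simp
    qed
    then have "?G (h(j := t)) = ?P (set l) h *\<^sub>R (indicat_real {y $ j..} t *\<^sub>R partial j (partials l \<psi>) (?vec (set l) h + (t - y $ j) *\<^sub>R axis j 1))" for t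
      unfolding vec by (simp add: partials_Cons)
    then have "(LINT t|lborel. ?G (h(j := t))) = (LINT t|lborel. ?P (set l) h *\<^sub>R (indicat_real {y $ j..} t *\<^sub>R partial j (partials l \<psi>) (?vec (set l) h + (t - y $ j) *\<^sub>R axis j 1)))"
      by (intro Bochner_Integration.integral_cong refl)
    also have "\<dots> = ?P (set l) h *\<^sub>R (- partials l \<psi> (?vec (set l) h))"
      unfolding integral_scaleR_right integral_half_line_partial[OF \<eta>] ..
    finally show "(LINT t|lborel. ?G (h(j := t))) = - (?P (set l) h *\<^sub>R partials l \<psi> (?vec (set l) h))"
      by simp
  qed
  also have "\<dots> = (- 1) ^ length (j # l) * \<psi> y"
    by (simp add: IH)
  finally show ?case .
qed

section \<open>Pairing a generalized density with a test function\<close>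

text \<open>The outermost \<open>gen_deriv\<close> acts on the test function first and so
  contributes its innermost derivative; hence the reversal.\<close>

lemma foldr_gen_deriv:
  "foldr gen_deriv is T \<psi> = (- 1) ^ length is * T (partials (rev is) \<psi>)"
  by (induction "is" arbitrary: \<psi>) (simp_all add: gen_deriv_def partials_append partials_Cons)

lemma coordinates: "distinct (coordinates :: 'd::finite list)" "set (coordinates :: 'd list) = UNIV"
proof -
  have "\<exists>is :: 'd list. distinct is \<and> set is = UNIV"
    using finite_distinct_list[of "UNIV :: 'd set"] by auto
  from someI_ex[OF this] show "distinct (coordinates :: 'd list)" "set (coordinates :: 'd list) = UNIV"
    unfolding coordinates_def by auto
qed

text \<open>Write the distribution function at \<open>x\<close> as the integral over
  \<open>y\<close> of the indicator of \<open>y \<le> x\<close> and exchange the integrals. For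
  fixed \<open>y\<close> there remains the full mixed derivative of \<open>\<psi>\<close> integrated
  over the orthant above \<open>y\<close>, which is \<open>\<psi> y\<close> up to sign.\<close>

lemma gen_density_eq_integral:
  fixes \<mu> :: "(real ^ 'd::finite) measure"
  assumes "prob_space \<mu>" and sets[measurable_cong]: "sets \<mu> = sets borel" and \<psi>: "\<psi> \<in> Schwartz"
  shows "gen_density \<mu> \<psi> = (LINT x|\<mu>. \<psi> x)"
proof -
  interpret prob_space \<mu> by fact
  interpret pair_sigma_finite \<mu> "lborel :: (real ^ 'd) measure" ..
  define l where "l = rev (coordinates :: 'd list)"
  have l: "distinct l" "set l = UNIV" "length (coordinates :: 'd list) = length l"
    by (simp_all add: l_def coordinates)
  define D where "D = partials l \<psi>"
  have D: "D \<in> Schwartz" unfolding D_def by (intro partials_Schwartz \<psi>)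
  have [measurable]: "D \<in> borel_measurable borel"
    by (intro borel_measurable_continuous_onI Schwartz_continuous D)
  \<comment> \<open>The product form gives joint measurability and matches
    \<open>integral_orthant_partials\<close>; \<open>P_eq\<close> is the form used for
    bounds.\<close>
  define P :: "real ^ 'd \<Rightarrow> real ^ 'd \<Rightarrow> real" where "P y x = (\<Prod>i\<in>UNIV. indicat_real {0..} ((x - y) $ i))" for y x
  have P_eq: "P y x = (if \<forall>i. y $ i \<le> x $ i then 1 else 0)" for y x
    by (auto simp: P_def indicator_def)
  have [measurable]: "(\<lambda>p. P (fst p) (snd p)) \<in> borel_measurable (borel \<Otimes>\<^sub>M borel)"
    unfolding P_def by measurable
  have [measurable]: "(\<lambda>x. P y x) \<in> borel_measurable borel" "(\<lambda>y. P y x) \<in> borel_measurable borel" for x y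
    unfolding P_def by measurable
  have F: "integrable (\<mu> \<Otimes>\<^sub>M lborel) (\<lambda>(y, x). P y x *\<^sub>R D x)"
  proof (rule Fubini_integrable)
    show "(\<lambda>(y, x). P y x *\<^sub>R D x) \<in> borel_measurable (\<mu> \<Otimes>\<^sub>M lborel)"
      unfolding case_prod_beta by measurable
    have intP: "integrable lborel (\<lambda>x. P y x *\<^sub>R D x)" for y
      by (rule Bochner_Integration.integrable_bound[OF Schwartz_integrable[OF D]]) (auto simp: P_eq)
    then show "AE y in \<mu>. integrable lborel (\<lambda>x. case (y, x) of (y, x) \<Rightarrow> P y x *\<^sub>R D x)" by simp
    show "integrable \<mu> (\<lambda>y. LINT x|lborel. norm (case (y, x) of (y, x) \<Rightarrow> P y x *\<^sub>R D x))"
    proof (rule integrable_const_bound)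
      have "(LINT x|lborel. norm (P y x *\<^sub>R D x)) \<le> (LINT x|lborel. norm (D x))" for y
        using Schwartz_integrable[OF D] by (intro integral_mono') (auto simp: P_eq)
      then show "AE y in \<mu>. norm (LINT x|lborel. norm (case (y, x) of (y, x) \<Rightarrow> P y x *\<^sub>R D x)) \<le> (LINT x|lborel. norm (D x))"
        by simp
      show "(\<lambda>y. LINT x|lborel. norm (case (y, x) of (y, x) \<Rightarrow> P y x *\<^sub>R D x)) \<in> borel_measurable \<mu>"
        unfolding P_def by measurable
    qed
  qed
  have df: "distribution_function \<mu> x = (LINT y|\<mu>. P y x)" for x
  proof -
    have "(LINT y|\<mu>. P y x) = (LINT y|\<mu>. indicator {y. \<forall>i. y $ i \<le> x $ i} y)"
      by (intro Bochner_Integration.integral_cong) (auto simp: P_eq)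
    then show ?thesis
      using sets_eq_imp_space_eq[OF sets] by (simp add: distribution_function_def)
  qed
  have "gen_density \<mu> \<psi> = (- 1) ^ length l * (LINT x|lborel. complex_of_real (LINT y|\<mu>. P y x) * D x)"
    by (simp add: gen_density_def foldr_gen_deriv regular_def l l_def[symmetric] D_def[symmetric] df)
  also have "(LINT x|lborel. complex_of_real (LINT y|\<mu>. P y x) * D x) = (LINT x|lborel. LINT y|\<mu>. P y x *\<^sub>R D x)"
  proof (intro Bochner_Integration.integral_cong refl)
    fix x
    have "integrable \<mu> (\<lambda>y. P y x)" by (rule integrable_const_bound[of _ 1]) (auto simp: P_eq)
    then show "complex_of_real (LINT y|\<mu>. P y x) * D x = (LINT y|\<mu>. P y x *\<^sub>R D x)"
      by (subst integral_scaleR_left) (simp_all add: scaleR_conv_of_real)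
  qed
  also have "\<dots> = (LINT y|\<mu>. LINT x|lborel. P y x *\<^sub>R D x)"
    using Fubini_integral[OF F] by simp
  also have "\<dots> = (LINT y|\<mu>. (- 1) ^ length l * \<psi> y)"
  proof (intro Bochner_Integration.integral_cong refl)
    fix y
    have "(LINT x|lborel. P y x *\<^sub>R D x) = (LINT h|(\<Pi>\<^sub>M i\<in>UNIV. lborel). P y (\<chi> i. h i) *\<^sub>R D (\<chi> i. h i))"
      by (rule integral_lborel_vec) measurable
    also have "\<dots> = (LINT h|(\<Pi>\<^sub>M i\<in>set l. lborel). (\<Prod>i\<in>set l. indicat_real {y $ i..} (h i)) *\<^sub>R
      partials l \<psi> (\<chi> i. if i \<in> set l then h i else y $ i))"
      by (simp add: l P_def D_def indicator_def of_bool_def)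
    finally show "(LINT x|lborel. P y x *\<^sub>R D x) = (- 1) ^ length l * \<psi> y"
      unfolding integral_orthant_partials[OF \<psi> l(1)] .
  qed
  \<comment> \<open>The sign from the generalized derivatives cancels the one from integrating out
    the coordinates.\<close>
  also have "(- 1) ^ length l * \<dots> = (LINT x|\<mu>. \<psi> x)"
    by (simp flip: mult.assoc power_add)
  finally show ?thesis .
qed

lemma has_gen_density_integral:
  assumes "has_gen_density \<mu> g" "\<psi> \<in> Schwartz"
  shows "g \<psi> = (LINT x|\<mu>. \<psi> x)"
  using assms gen_density_eq_integral[of \<mu> \<psi>] by (simp add: has_gen_density_def dist_eq_def)

section \<open>Gaussian test functions\<close>

text \<open>Imaginary \<open>c\<close> gives the modulated Gaussians used as test functions; real
  \<open>c\<close> gives, up to a constant, their Fourier transforms. Complex coefficients cover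
  both at once.\<close>

definition gexp :: "('d::finite \<Rightarrow> complex) \<Rightarrow> 'd test_fun" where
  "gexp c x = exp (\<Sum>i\<in>UNIV. c i * complex_of_real (x $ i) - complex_of_real ((x $ i)\<^sup>2 / 2))"

text \<open>Polynomial multiples of \<^const>\<open>gexp\<close>, a class closed under differentiation.\<close>

inductive gpoly :: "('d::finite \<Rightarrow> complex) \<Rightarrow> 'd test_fun \<Rightarrow> bool" for c where
  gexp: "gpoly c (gexp c)"
| coord: "gpoly c q \<Longrightarrow> gpoly c (\<lambda>x. complex_of_real (x $ i) * q x)"
| lincomb: "gpoly c p \<Longrightarrow> gpoly c q \<Longrightarrow> gpoly c (\<lambda>x. a * p x + b * q x)"

lemma gexp_has_derivative:
  "(gexp c has_derivative (\<lambda>h. gexp c x * (\<Sum>i\<in>UNIV. (c i - complex_of_real (x $ i)) * complex_of_real (h $ i)))) (at x)"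
proof -
  have nth: "((\<lambda>x. complex_of_real (x $ i)) has_derivative (\<lambda>h. complex_of_real (h $ i))) (at x)" for i
    by (intro has_derivative_of_real bounded_linear_imp_has_derivative bounded_linear_vec_nth)
  have "((\<lambda>x. \<Sum>i\<in>UNIV. c i * complex_of_real (x $ i) - 1 / 2 * (complex_of_real (x $ i) * complex_of_real (x $ i)))
    has_derivative (\<lambda>h. \<Sum>i\<in>UNIV. c i * complex_of_real (h $ i)
      - 1 / 2 * (complex_of_real (x $ i) * complex_of_real (h $ i) + complex_of_real (h $ i) * complex_of_real (x $ i)))) (at x)"
    by (intro has_derivative_sum has_derivative_diff has_derivative_mult has_derivative_mult_right nth)
  from has_derivative_compose[OF this DERIV_exp[unfolded has_field_derivative_def]]
  have "((\<lambda>x. exp (\<Sum>i\<in>UNIV. c i * complex_of_real (x $ i) - 1 / 2 * (complex_of_real (x $ i) * complex_of_real (x $ i))))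
    has_derivative (\<lambda>h. exp (\<Sum>i\<in>UNIV. c i * complex_of_real (x $ i) - 1 / 2 * (complex_of_real (x $ i) * complex_of_real (x $ i)))
      * (\<Sum>i\<in>UNIV. c i * complex_of_real (h $ i)
      - 1 / 2 * (complex_of_real (x $ i) * complex_of_real (h $ i) + complex_of_real (h $ i) * complex_of_real (x $ i))))) (at x)" .
  then show ?thesis
    unfolding gexp_def[abs_def] by (simp add: power2_eq_square algebra_simps)
qed

lemma sum_axis: "(\<Sum>j\<in>UNIV. f j * complex_of_real (axis i 1 $ j)) = f i"
  by (simp add: axis_def if_distrib[of complex_of_real] if_distrib[of "(*) _"] cong: if_cong)

text \<open>Differentiability is proved in the same induction because the product and sum rules for
  \<open>partial\<close> call for it on the constituents.\<close>

lemma gpoly_partial: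
  assumes "gpoly c q"
  shows "(\<forall>x. q differentiable (at x)) \<and> gpoly c (partial i q)"
  using assms
proof induction
  case gexp
  have "partial i (gexp c) = (\<lambda>x. c i * gexp c x + (- 1) * (complex_of_real (x $ i) * gexp c x))"
    unfolding fun_eq_iff partial_eqI[OF gexp_has_derivative] sum_axis by (simp add: algebra_simps)
  moreover have "gpoly c (\<lambda>x. c i * gexp c x + (- 1) * (complex_of_real (x $ i) * gexp c x))"
    by (intro gpoly.intros)
  moreover have "gexp c differentiable (at x)" for x
    using gexp_has_derivative by (rule differentiableI)
  ultimately show ?case by simp
next
  case (coord q j)
  have D: "((\<lambda>x. complex_of_real (x $ j) * q x) has_derivative
    (\<lambda>h. complex_of_real (x $ j) * frechet_derivative q (at x) h + complex_of_real (h $ j) * q x)) (at x)" for x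
    using coord.IH
    by (intro has_derivative_mult has_derivative_of_real bounded_linear_imp_has_derivative bounded_linear_vec_nth)
       (simp add: frechet_derivative_works)
  have "partial i (\<lambda>x. complex_of_real (x $ j) * q x)
    = (\<lambda>x. 1 * (complex_of_real (x $ j) * partial i q x) + complex_of_real (axis i 1 $ j) * q x)"
    using partial_eqI[OF D, of i] by (simp add: fun_eq_iff partial_def)
  moreover have "gpoly c (\<lambda>x. 1 * (complex_of_real (x $ j) * partial i q x) + complex_of_real (axis i 1 $ j) * q x)"
    using coord by (intro gpoly.intros) auto
  moreover note differentiableI[OF D]
  ultimately show ?case by simp
next
  case (lincomb p q a b)
  have D: "((\<lambda>x. a * p x + b * q x) has_derivative
    (\<lambda>h. a * frechet_derivative p (at x) h + b * frechet_derivative q (at x) h)) (at x)" for x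
    using lincomb.IH
    by (intro has_derivative_add has_derivative_mult_right) (simp_all add: frechet_derivative_works)
  have "partial i (\<lambda>x. a * p x + b * q x) = (\<lambda>x. a * partial i p x + b * partial i q x)"
    using partial_eqI[OF D, of i] by (simp add: fun_eq_iff partial_def)
  moreover have "gpoly c (\<lambda>x. a * partial i p x + b * partial i q x)"
    using lincomb by (intro gpoly.intros) auto
  moreover note differentiableI[OF D]
  ultimately show ?case by simp
qed

lemma gpoly_partials: "gpoly c q \<Longrightarrow> gpoly c (partials is q)"
  by (induction "is") (simp_all add: partials_Cons gpoly_partial)

lemma gpoly_monomial:
  assumes "gpoly c q"
  shows "gpoly c (\<lambda>x. monomial \<alpha> x *\<^sub>R q x)"
proof -
  have pow: "gpoly c (\<lambda>x. complex_of_real ((x $ i) ^ n) * p x)" if "gpoly c p" for p i n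
  proof (induction n)
    case (Suc n)
    from gpoly.coord[OF this, of i] show ?case by (simp add: mult.assoc)
  qed (use that in simp)
  have "gpoly c (\<lambda>x. complex_of_real (\<Prod>i\<in>A. (x $ i) ^ \<alpha> i) * q x)" if "finite A" for A
    using that
  proof (induction A)
    case (insert i A)
    from pow[OF insert.IH, of i "\<alpha> i"] insert.hyps show ?case
      by (simp add: mult.assoc)
  qed (use assms in simp)
  from this[of UNIV] show ?thesis by (simp add: monomial_def scaleR_conv_of_real)
qed

text \<open>A coordinate factor is absorbed by giving up half of \<open>\<delta>\<close>, so
  \<open>\<delta>\<close> must vary in the induction. With \<open>\<delta> = 1 / 2\<close> the
  exponent vanishes and plain boundedness results.\<close>

lemma gpoly_bound:
  assumes "gpoly c q" "0 < \<delta>"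
  shows "\<exists>C\<ge>0. \<forall>x. norm (q x) \<le> C * exp (\<delta> * (x \<bullet> x) - (x \<bullet> x) / 2)"
  using assms
proof (induction arbitrary: \<delta>)
  case gexp
  have "norm (gexp c x) \<le> exp (\<Sum>i\<in>UNIV. (Re (c i))\<^sup>2 / (4 * \<delta>)) * exp (\<delta> * (x \<bullet> x) - (x \<bullet> x) / 2)" for x
  proof -
    \<comment> \<open>Completing the square.\<close>
    have "Re (c i) * u \<le> \<delta> * u\<^sup>2 + (Re (c i))\<^sup>2 / (4 * \<delta>)" for i u
    proof -
      have "0 \<le> (2 * \<delta> * u - Re (c i))\<^sup>2 / (4 * \<delta>)" using gexp by simp
      also have "\<dots> = \<delta> * u\<^sup>2 - Re (c i) * u + (Re (c i))\<^sup>2 / (4 * \<delta>)"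
        using gexp by (simp add: power2_eq_square field_simps)
      finally show ?thesis by simp
    qed
    then have "(\<Sum>i\<in>UNIV. Re (c i) * (x $ i) - (x $ i)\<^sup>2 / 2) \<le> (\<Sum>i\<in>UNIV. (\<delta> * (x $ i)\<^sup>2 + (Re (c i))\<^sup>2 / (4 * \<delta>)) - (x $ i)\<^sup>2 / 2)"
      by (intro sum_mono diff_right_mono)
    also have "\<dots> = (\<Sum>i\<in>UNIV. (Re (c i))\<^sup>2 / (4 * \<delta>)) + (\<delta> * (x \<bullet> x) - (x \<bullet> x) / 2)"
      by (simp add: inner_vec_def power2_eq_square sum.distrib sum_subtractf sum_distrib_left sum_divide_distrib)
    finally show ?thesis
      by (simp add: gexp_def Re_sum exp_add[symmetric])
  qed
  then show ?case by (intro exI[of _ "exp (\<Sum>i\<in>UNIV. (Re (c i))\<^sup>2 / (4 * \<delta>))"]) simp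
next
  case (coord q i)
  then obtain C where C: "0 \<le> C" "\<And>x. norm (q x) \<le> C * exp (\<delta> / 2 * (x \<bullet> x) - (x \<bullet> x) / 2)"
    using coord.IH[of "\<delta> / 2"] by auto
  \<comment> \<open>With \<open>?E = exp (\<delta> / 2 * (x \<bullet> x))\<close>, both
    \<open>1 \<le> ?E\<close> and \<open>x \<bullet> x \<le> 2 / \<delta> * ?E\<close> hold; adding
    them bounds \<open>1 + x \<bullet> x\<close>, hence the coordinate.\<close>
  have "norm (complex_of_real (x $ i) * q x) \<le> (1 + 2 / \<delta>) * C * exp (\<delta> * (x \<bullet> x) - (x \<bullet> x) / 2)" for x
  proof -
    let ?E = "exp (\<delta> / 2 * (x \<bullet> x))"
    have "\<delta> / 2 * (x \<bullet> x) \<le> ?E"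
      using exp_ge_add_one_self[of "\<delta> / 2 * (x \<bullet> x)"] by linarith
    then have "x \<bullet> x \<le> 2 / \<delta> * ?E" using coord.prems by (simp add: field_simps)
    moreover have "1 \<le> ?E" using coord.prems by simp
    moreover have "\<bar>x $ i\<bar> \<le> 1 + x \<bullet> x"
    proof -
      have "\<bar>x $ i\<bar> \<le> norm x" by (rule component_le_norm_cart)
      also have "norm x \<le> 1 + (norm x)\<^sup>2"
        using sum_squares_bound[of 1 "norm x"] norm_ge_zero[of x] by (simp del: norm_ge_zero)
      finally show ?thesis by (simp add: power2_norm_eq_inner)
    qed
    ultimately have "\<bar>x $ i\<bar> \<le> ?E + 2 / \<delta> * ?E" by linarith
    then have "\<bar>x $ i\<bar> \<le> (1 + 2 / \<delta>) * ?E" by (simp only: distrib_right mult_1)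
    then have "norm (complex_of_real (x $ i) * q x) \<le> ((1 + 2 / \<delta>) * ?E) * (C * exp (\<delta> / 2 * (x \<bullet> x) - (x \<bullet> x) / 2))"
      unfolding norm_mult norm_of_real using C coord.prems by (intro mult_mono) auto
    also have "\<dots> = (1 + 2 / \<delta>) * C * (?E * exp (\<delta> / 2 * (x \<bullet> x) - (x \<bullet> x) / 2))" by simp
    also have "?E * exp (\<delta> / 2 * (x \<bullet> x) - (x \<bullet> x) / 2) = exp (\<delta> * (x \<bullet> x) - (x \<bullet> x) / 2)"
      by (simp add: exp_add[symmetric])
    finally show ?thesis .
  qed
  then show ?case using C(1) coord.prems by (intro exI[of _ "(1 + 2 / \<delta>) * C"]) simp
next
  case (lincomb p q a b)
  obtain C where C: "0 \<le> C" "\<And>x. norm (p x) \<le> C * exp (\<delta> * (x \<bullet> x) - (x \<bullet> x) / 2)"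
    using lincomb.IH(1)[OF lincomb.prems] by auto
  obtain D where D: "0 \<le> D" "\<And>x. norm (q x) \<le> D * exp (\<delta> * (x \<bullet> x) - (x \<bullet> x) / 2)"
    using lincomb.IH(2)[OF lincomb.prems] by auto
  have "norm (a * p x + b * q x) \<le> (norm a * C + norm b * D) * exp (\<delta> * (x \<bullet> x) - (x \<bullet> x) / 2)" for x
    unfolding distrib_right mult.assoc
    by (intro norm_triangle_mono) (simp_all add: norm_mult mult_left_mono C D)
  then show ?case using C(1) D(1) by (intro exI[of _ "norm a * C + norm b * D"]) simp
qed

lemma gexp_Schwartz: "gexp c \<in> Schwartz"
proof -
  have "partials is (gexp c) differentiable (at x)" for "is" x
    using gpoly_partial[OF gpoly_partials[OF gpoly.gexp]] by blast
  moreover have "bounded (range (\<lambda>x. monomial \<alpha> x *\<^sub>R partials is (gexp c) x))" for \<alpha> "is"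
    using gpoly_bound[OF gpoly_monomial[OF gpoly_partials[OF gpoly.gexp[of c]]], of "1 / 2" \<alpha> "is"]
    unfolding bounded_iff by auto
  ultimately show ?thesis by (simp add: Schwartz_def)
qed

lemma gexp_imaginary: "gexp (\<lambda>i. - \<i> * complex_of_real (t $ i)) x = complex_of_real (gauss x) * iexp (- (t \<bullet> x))"
proof -
  have "gexp (\<lambda>i. - \<i> * complex_of_real (t $ i)) x
    = exp (complex_of_real (- (x \<bullet> x) / 2) + \<i> * complex_of_real (- (t \<bullet> x)))"
    unfolding gexp_def
    by (simp add: inner_vec_def sum_subtractf sum_negf sum_distrib_left sum_divide_distrib power2_eq_square algebra_simps)
  then show ?thesis by (simp only: exp_add gauss_def exp_of_real)
qed

text \<open>The transform is a constant times \<open>gauss (s - t)\<close>. Expanding the square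
  shows this to be a multiple of \<open>gexp\<close> with the real coefficients
  \<open>t $ i\<close>.\<close>

lemma fourier_gexp_Schwartz:
  fixes t :: "real ^ 'd::finite"
  shows "fourier (gexp (\<lambda>i. - \<i> * complex_of_real (t $ i))) \<in> Schwartz"
proof -
  let ?K = "complex_of_real (sqrt (2 * pi) ^ CARD('d) * gauss t)"
  let ?c = "\<lambda>i. complex_of_real (t $ i)"
  have "fourier (gexp (\<lambda>i. - \<i> * complex_of_real (t $ i))) s = ?K * gexp ?c s + 0 * gexp ?c s" for s
  proof -
    have "gexp (\<lambda>i. - \<i> * complex_of_real (t $ i)) x * iexp (x \<bullet> s) = complex_of_real (gauss x) * iexp ((s - t) \<bullet> x)" for x
      unfolding gexp_imaginary mult.assoc exp_add[symmetric]
      by (simp add: inner_diff_left inner_commute algebra_simps)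
    then have "fourier (gexp (\<lambda>i. - \<i> * complex_of_real (t $ i))) s = complex_of_real (sqrt (2 * pi) ^ CARD('d) * gauss (s - t))"
      unfolding fourier_def by (simp only: gauss_fourier(2))
    moreover have "complex_of_real (gauss (s - t)) = complex_of_real (gauss t) * gexp ?c s"
    proof -
      have "gexp ?c s = complex_of_real (exp (t \<bullet> s - (s \<bullet> s) / 2))"
        unfolding gexp_def exp_of_real[symmetric]
        by (simp add: inner_vec_def sum_subtractf sum_divide_distrib power2_eq_square)
      moreover have "gauss (s - t) = gauss t * exp (t \<bullet> s - (s \<bullet> s) / 2)"
        unfolding gauss_def exp_add[symmetric]
        by (simp add: inner_diff_left inner_diff_right inner_commute field_simps)
      ultimately show ?thesis by simp
    qed
    ultimately show ?thesis by simp
  qed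
  then have "fourier (gexp (\<lambda>i. - \<i> * complex_of_real (t $ i))) = (\<lambda>s. ?K * gexp ?c s + 0 * gexp ?c s)" by blast
  then show ?thesis by (simp only: Schwartz_lincomb gexp_Schwartz)
qed

text \<open>The integrals are, up to a constant, the values of \<open>inv_fourier\<close> at the
  integrable function \<open>b x * gauss x\<close>, and \<open>gauss\<close> has no zeros. The
  detour through this product admits functions \<open>b\<close> that are only bounded.\<close>

lemma AE_eq_0_if_gexp_integrals_0:
  fixes b :: "real ^ 'd::finite \<Rightarrow> complex"
  assumes int: "integrable lborel (\<lambda>x. b x * gexp (\<lambda>i. - \<i> * complex_of_real ((0::real^'d) $ i)) x)"
    and 0: "\<And>t. (LINT x|lborel. b x * gexp (\<lambda>i. - \<i> * complex_of_real (t $ i)) x) = 0"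
  shows "AE x in lborel. b x = 0"
proof -
  have int': "integrable lborel (\<lambda>x. b x * complex_of_real (gauss x))"
    using int unfolding gexp_imaginary by simp
  have "inv_fourier (\<lambda>x. b x * complex_of_real (gauss x)) t = 0" for t
    using 0[of t] unfolding gexp_imaginary inv_fourier_def by (simp add: mult.assoc)
  from inv_fourier_eq_0_imp_AE_eq_0[OF int' this] show ?thesis
    by eventually_elim (simp add: gauss_def)
qed

section \<open>Characteristic functions\<close>

definition cf :: "(real ^ 'd::finite) measure \<Rightarrow> real ^ 'd \<Rightarrow> complex" where
  "cf \<mu> s = (LINT x|\<mu>. iexp (s \<bullet> x))"

lemma cf_measurable:
  fixes \<mu> :: "(real ^ 'd::finite) measure"
  assumes "prob_space \<mu>" and [measurable_cong]: "sets \<mu> = sets borel"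
  shows "cf \<mu> \<in> borel_measurable borel"
proof -
  interpret prob_space \<mu> by fact
  show ?thesis unfolding cf_def[abs_def] by measurable
qed

lemma norm_cf_le_1:
  assumes "prob_space \<mu>" shows "norm (cf \<mu> s) \<le> 1"
proof -
  interpret prob_space \<mu> by fact
  have "norm (cf \<mu> s) \<le> (LINT x|\<mu>. norm (iexp (s \<bullet> x)))"
    unfolding cf_def by (rule integral_norm_bound)
  then show ?thesis by (simp add: prob_space)
qed

text \<open>Fubini's theorem; the double integrand has modulus \<open>norm (b s)\<close> and
  \<open>\<mu>\<close> is a probability measure.\<close>

lemma integral_fourier_eq:
  fixes b :: "'d::finite test_fun"
  assumes "prob_space \<mu>" and sets[measurable_cong]: "sets \<mu> = sets borel" and int: "integrable lborel b"
  shows "(LINT z|\<mu>. fourier b z) = (LINT s|lborel. b s * cf \<mu> s)"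
proof -
  interpret prob_space \<mu> by fact
  interpret pair_sigma_finite \<mu> "lborel :: (real ^ 'd) measure" ..
  have [measurable]: "b \<in> borel_measurable borel" using int by simp
  have F: "integrable (\<mu> \<Otimes>\<^sub>M lborel) (\<lambda>(z, s). b s * iexp (s \<bullet> z))"
  proof (rule Fubini_integrable)
    show "(\<lambda>(z, s). b s * iexp (s \<bullet> z)) \<in> borel_measurable (\<mu> \<Otimes>\<^sub>M lborel)" by measurable
    show "integrable \<mu> (\<lambda>z. LINT s|lborel. norm (case (z, s) of (z, s) \<Rightarrow> b s * iexp (s \<bullet> z)))"
      by (simp add: norm_mult)
    have "integrable lborel (\<lambda>s. b s * iexp (s \<bullet> z))" for z
      using integrable_mult_iexp[OF int, of "\<lambda>s. s \<bullet> z"] by simp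
    then show "AE z in \<mu>. integrable lborel (\<lambda>s. case (z, s) of (z, s) \<Rightarrow> b s * iexp (s \<bullet> z))" by simp
  qed
  have "(LINT z|\<mu>. fourier b z) = (LINT s|lborel. LINT z|\<mu>. b s * iexp (s \<bullet> z))"
    unfolding fourier_def using Fubini_integral[OF F] by simp
  also have "\<dots> = (LINT s|lborel. b s * cf \<mu> s)"
    unfolding cf_def by (simp only: integral_mult_right_zero)
  finally show ?thesis .
qed

lemma integrable_gexp_cf:
  assumes "prob_space \<mu>" "sets \<mu> = sets borel"
  shows "integrable lborel (\<lambda>s. cf \<mu> s * gexp c s)"
  by (rule Bochner_Integration.integrable_bound[OF Schwartz_integrable[OF gexp_Schwartz]])
     (auto simp: norm_mult cf_measurable assms intro!: AE_I2 mult_left_le_one_le norm_cf_le_1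
        borel_measurable_times Schwartz_measurable[OF gexp_Schwartz])

lemma Ft_gen_density_gexp:
  assumes "has_gen_density \<mu> f"
  shows "Ft f (gexp (\<lambda>i. - \<i> * complex_of_real (t $ i)))
    = (LINT s|lborel. cf \<mu> s * gexp (\<lambda>i. - \<i> * complex_of_real (t $ i)) s)"
  unfolding Ft_def has_gen_density_integral[OF assms fourier_gexp_Schwartz]
  using assms by (simp add: integral_fourier_eq Schwartz_integrable gexp_Schwartz has_gen_density_def mult.commute)

text \<open>Transfers information from \<open>G \<star> F\<close> to the law of an observation,
  which shares with it the generalized density \<open>w\<close>.\<close>

lemma cf_unique_AE:
  assumes "has_gen_density \<mu> w" "has_gen_density \<nu> w"
  shows "AE s in lborel. cf \<mu> s = cf \<nu> s"
proof -
  have int: "integrable lborel (\<lambda>s. cf \<mu> s * gexp c s)" "integrable lborel (\<lambda>s. cf \<nu> s * gexp c s)" for c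
    using assms by (auto intro!: integrable_gexp_cf simp: has_gen_density_def)
  have "AE s in lborel. cf \<mu> s - cf \<nu> s = 0"
  proof (rule AE_eq_0_if_gexp_integrals_0)
    show "integrable lborel (\<lambda>x. (cf \<mu> x - cf \<nu> x) * gexp c x)" for c
      unfolding left_diff_distrib by (intro Bochner_Integration.integrable_diff int)
    show "(LINT x|lborel. (cf \<mu> x - cf \<nu> x) * gexp (\<lambda>i. - \<i> * complex_of_real (t $ i)) x) = 0" for t
      unfolding left_diff_distrib Bochner_Integration.integral_diff[OF int]
      using Ft_gen_density_gexp[OF assms(1), of t] Ft_gen_density_gexp[OF assms(2), of t] by simp
  qed
  then show ?thesis by simp
qed

lemma represented_by_cf_AE:
  assumes "has_gen_density \<mu> f" "represented_by (Ft f) \<phi>"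
  shows "AE s in lborel. \<phi> s = cf \<mu> s"
proof -
  have int: "integrable lborel (\<lambda>s. cf \<mu> s * gexp c s)" "integrable lborel (\<lambda>s. \<phi> s * gexp c s)" for c
    using assms by (auto intro!: integrable_gexp_cf simp: has_gen_density_def represented_by_def gexp_Schwartz)
  have "AE s in lborel. \<phi> s - cf \<mu> s = 0"
  proof (rule AE_eq_0_if_gexp_integrals_0)
    show "integrable lborel (\<lambda>x. (\<phi> x - cf \<mu> x) * gexp c x)" for c
      unfolding left_diff_distrib by (intro Bochner_Integration.integrable_diff int)
    show "(LINT x|lborel. (\<phi> x - cf \<mu> x) * gexp (\<lambda>i. - \<i> * complex_of_real (t $ i)) x) = 0" for t
      unfolding left_diff_distrib Bochner_Integration.integral_diff[OF int(2,1)]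
      using Ft_gen_density_gexp[OF assms(1), of t] assms(2)
      by (simp add: represented_by_def dist_eq_def regular_def gexp_Schwartz)
  qed
  then show ?thesis by simp
qed

lemma cf_convolution:
  fixes G F :: "(real ^ 'd::finite) measure"
  assumes "prob_space G" "prob_space F" and [measurable_cong]: "sets G = sets borel" "sets F = sets borel"
  shows "cf (G \<star> F) s = cf G s * cf F s"
proof -
  interpret G: prob_space G by fact
  interpret F: prob_space F by fact
  interpret pair_prob_space G F ..
  have "cf (G \<star> F) s = (LINT p|(G \<Otimes>\<^sub>M F). iexp (s \<bullet> (fst p + snd p)))"
    unfolding cf_def convolution_def by (subst integral_distr) (auto simp: case_prod_beta)
  also have "\<dots> = (LINT x|G. LINT y|F. iexp (s \<bullet> (x + y)))"
    by (subst integral_fst'[symmetric]) (auto intro!: integrable_const_bound[of _ 1])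
  also have "\<dots> = (LINT x|G. LINT y|F. iexp (s \<bullet> x) * iexp (s \<bullet> y))"
    by (simp add: inner_add_right exp_add[symmetric] algebra_simps)
  also have "\<dots> = cf G s * cf F s"
    unfolding cf_def by (simp only: integral_mult_right_zero integral_mult_left_zero)
  finally show ?thesis .
qed

section \<open>The deconvolution estimator\<close>

text \<open>Hoeffding's inequality for summands in \<open>{- C..C}\<close> bounds the probability by
  \<open>2 * q ^ n\<close> with
  \<open>q = exp (- \<epsilon>\<^sup>2 / (2 * C\<^sup>2)) < 1\<close>.\<close>

lemma weak_law_bounded:
  fixes Y :: "nat \<Rightarrow> 'a \<Rightarrow> real"
  assumes "prob_space M" and indep: "prob_space.indep_vars M (\<lambda>_. borel) Y {1..}"
    and bound: "\<And>j \<omega>. 1 \<le> j \<Longrightarrow> \<omega> \<in> space M \<Longrightarrow> \<bar>Y j \<omega>\<bar> \<le> B"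
    and mean: "\<And>j. 1 \<le> j \<Longrightarrow> (LINT \<omega>|M. Y j \<omega>) = \<mu>" and \<epsilon>: "0 < \<epsilon>"
  shows "(\<lambda>n. measure M {\<omega> \<in> space M. \<epsilon> \<le> \<bar>(\<Sum>j=1..n. Y j \<omega>) / real n - \<mu>\<bar>}) \<longlonglongrightarrow> 0"
proof -
  interpret prob_space M by fact
  \<comment> \<open>Strictly positive even when \<open>B = 0\<close>, so that the intervals in
    Hoeffding's inequality are nondegenerate.\<close>
  define C where "C = \<bar>B\<bar> + 1"
  have C: "0 < C" "B \<le> C" by (auto simp: C_def)
  let ?q = "\<epsilon>\<^sup>2 / (2 * C\<^sup>2)"
  have bd: "measure M {\<omega> \<in> space M. \<epsilon> \<le> \<bar>(\<Sum>j=1..n. Y j \<omega>) / real n - \<mu>\<bar>} \<le> 2 * exp (- ?q) ^ n" if n: "1 \<le> n" for n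
  proof -
    interpret H: Hoeffding_ineq M "{1..n}" Y "\<lambda>_. - C" "\<lambda>_. C" "\<Sum>j=1..n. expectation (Y j)"
    proof unfold_locales
      show "indep_vars (\<lambda>_. borel) Y {1..n}" using indep by (rule indep_vars_subset) auto
      show "AE \<omega> in M. Y j \<omega> \<in> {- C..C}" if "j \<in> {1..n}" for j
        using bound[of j] that C(2) by (intro AE_I2) fastforce
    qed auto
    have mn: "(\<Sum>j=1..n. expectation (Y j)) = real n * \<mu>" using mean by simp
    have "\<epsilon> \<le> \<bar>s / real n - \<mu>\<bar> \<longleftrightarrow> real n * \<epsilon> \<le> \<bar>s - real n * \<mu>\<bar>" for s
    proof -
      have "\<bar>s - real n * \<mu>\<bar> = real n * \<bar>s / real n - \<mu>\<bar>"
        using n by (subst abs_of_nat[symmetric], subst abs_mult[symmetric]) (simp add: right_diff_distrib)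
      then show ?thesis using n by simp
    qed
    then have "measure M {\<omega> \<in> space M. \<epsilon> \<le> \<bar>(\<Sum>j=1..n. Y j \<omega>) / real n - \<mu>\<bar>}
      = prob {\<omega> \<in> space M. real n * \<epsilon> \<le> \<bar>(\<Sum>j=1..n. Y j \<omega>) - (\<Sum>j=1..n. expectation (Y j))\<bar>}"
      unfolding mn by (simp only:)
    also have "\<dots> \<le> 2 * exp (- 2 * (real n * \<epsilon>)\<^sup>2 / (\<Sum>j=1..n. (C - (- C))\<^sup>2))"
      using n C(1) \<epsilon> by (intro H.Hoeffding_ineq_abs_ge) auto
    also have "- 2 * (real n * \<epsilon>)\<^sup>2 / (\<Sum>j=1..n. (C - (- C))\<^sup>2) = real n * (- ?q)"
      using n C(1) by (simp add: power2_eq_square field_simps)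
    also have "exp (real n * (- ?q)) = exp (- ?q) ^ n" by (rule exp_of_nat_mult)
    finally show ?thesis .
  qed
  have lim: "(\<lambda>n. 2 * exp (- ?q) ^ n) \<longlonglongrightarrow> 0"
    using C(1) \<epsilon> by (intro tendsto_mult_right_zero LIMSEQ_realpow_zero) auto
  show ?thesis
  proof (rule tendsto_sandwich[OF _ _ tendsto_const lim])
    show "\<forall>\<^sub>F n in sequentially. measure M {\<omega> \<in> space M. \<epsilon> \<le> \<bar>(\<Sum>j=1..n. Y j \<omega>) / real n - \<mu>\<bar>} \<le> 2 * exp (- ?q) ^ n"
      using eventually_ge_at_top[of 1] by eventually_elim (rule bd)
  qed (intro always_eventually allI measure_nonneg)
qed

lemma norm_vec_complex_le:
  fixes v :: "complex ^ 'v::finite"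
  shows "norm v \<le> (\<Sum>k\<in>UNIV. \<bar>Re (v $ k)\<bar> + \<bar>Im (v $ k)\<bar>)"
proof -
  have "norm v \<le> (\<Sum>k\<in>UNIV. norm (v $ k))" unfolding norm_vec_def by (rule L2_set_le_sum) simp
  also have "\<dots> \<le> (\<Sum>k\<in>UNIV. \<bar>Re (v $ k)\<bar> + \<bar>Im (v $ k)\<bar>)" by (intro sum_mono cmod_le)
  finally show ?thesis .
qed

lemma borel_measurable_complex_vec:
  fixes X :: "'v::finite \<Rightarrow> 'a \<Rightarrow> complex"
  assumes "\<And>k. X k \<in> borel_measurable M"
  shows "(\<lambda>\<omega>. \<chi> k. X k \<omega>) \<in> borel_measurable M"
  unfolding borel_measurable_euclidean_space[of "\<lambda>\<omega>. \<chi> k. X k \<omega>"]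
  using assms by (auto simp: Basis_vec_def inner_axis intro!: borel_measurable_inner)

text \<open>If the norm exceeds \<open>\<epsilon>\<close>, one of the \<open>2 * CARD('v)\<close>
  real and imaginary parts is at least \<open>\<epsilon> / (2 * CARD('v))\<close> in absolute value;
  then a union bound.\<close>

lemma tendsto_in_prob_vec:
  fixes X :: "nat \<Rightarrow> 'v::finite \<Rightarrow> 'a \<Rightarrow> complex"
  assumes "prob_space M" and meas: "\<And>n k. X n k \<in> borel_measurable M"
    and Re: "\<And>k \<epsilon>. 0 < \<epsilon> \<Longrightarrow> (\<lambda>n. measure M {\<omega> \<in> space M. \<epsilon> \<le> \<bar>Re (X n k \<omega>)\<bar>}) \<longlonglongrightarrow> 0"
    and Im: "\<And>k \<epsilon>. 0 < \<epsilon> \<Longrightarrow> (\<lambda>n. measure M {\<omega> \<in> space M. \<epsilon> \<le> \<bar>Im (X n k \<omega>)\<bar>}) \<longlonglongrightarrow> 0"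
  shows "tendsto_in_prob M (\<lambda>n \<omega>. \<chi> k. X n k \<omega>) (\<lambda>_. 0)"
proof -
  interpret prob_space M by fact
  note meas [measurable]
  have "(\<lambda>n. measure M {\<omega> \<in> space M. \<epsilon> < dist (\<chi> k. X n k \<omega>) 0}) \<longlonglongrightarrow> 0" if \<epsilon>: "0 < \<epsilon>" for \<epsilon>
  proof -
    define \<delta> where "\<delta> = \<epsilon> / (2 * real CARD('v))"
    have \<delta>: "0 < \<delta>" using \<epsilon> by (simp add: \<delta>_def)
    let ?R = "\<lambda>n k. {\<omega> \<in> space M. \<delta> \<le> \<bar>Re (X n k \<omega>)\<bar>}"
    let ?I = "\<lambda>n k. {\<omega> \<in> space M. \<delta> \<le> \<bar>Im (X n k \<omega>)\<bar>}"
    have le: "prob {\<omega> \<in> space M. \<epsilon> < dist (\<chi> k. X n k \<omega>) 0} \<le> (\<Sum>k\<in>UNIV. prob (?R n k) + prob (?I n k))" for n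
    proof -
      have "prob {\<omega> \<in> space M. \<epsilon> < dist (\<chi> k. X n k \<omega>) 0} \<le> prob (\<Union>k\<in>UNIV. ?R n k \<union> ?I n k)"
      proof (rule finite_measure_mono)
        show "{\<omega> \<in> space M. \<epsilon> < dist (\<chi> k. X n k \<omega>) 0} \<subseteq> (\<Union>k\<in>UNIV. ?R n k \<union> ?I n k)"
        proof
          fix \<omega> assume \<omega>: "\<omega> \<in> {\<omega> \<in> space M. \<epsilon> < dist (\<chi> k. X n k \<omega>) 0}"
          show "\<omega> \<in> (\<Union>k\<in>UNIV. ?R n k \<union> ?I n k)"
          proof (rule ccontr)
            assume "\<omega> \<notin> (\<Union>k\<in>UNIV. ?R n k \<union> ?I n k)"
            then have "\<bar>Re (X n k \<omega>)\<bar> < \<delta>" "\<bar>Im (X n k \<omega>)\<bar> < \<delta>" for k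
              using \<omega> by (auto simp: not_le)
            from add_mono[OF less_imp_le[OF this(1)] less_imp_le[OF this(2)]]
            have "\<bar>Re (X n k \<omega>)\<bar> + \<bar>Im (X n k \<omega>)\<bar> \<le> 2 * \<delta>" for k by simp
            then have "(\<Sum>k\<in>UNIV. \<bar>Re (X n k \<omega>)\<bar> + \<bar>Im (X n k \<omega>)\<bar>) \<le> (\<Sum>k\<in>(UNIV :: 'v set). 2 * \<delta>)"
              by (intro sum_mono)
            also have "\<dots> = \<epsilon>" by (simp add: \<delta>_def)
            finally show False
              using norm_vec_complex_le[of "\<chi> k. X n k \<omega>"] \<omega> by simp
          qed
        qed
        show "(\<Union>k\<in>UNIV. ?R n k \<union> ?I n k) \<in> events"
          by (intro sets.finite_UN sets.Un) auto
      qed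
      also have "\<dots> \<le> (\<Sum>k\<in>UNIV. prob (?R n k \<union> ?I n k))"
        by (intro finite_measure_subadditive_finite) auto
      also have "\<dots> \<le> (\<Sum>k\<in>UNIV. prob (?R n k) + prob (?I n k))"
        by (intro sum_mono measure_Un_le) auto
      finally show ?thesis .
    qed
    have lim: "(\<lambda>n. \<Sum>k\<in>UNIV. prob (?R n k) + prob (?I n k)) \<longlonglongrightarrow> (\<Sum>k\<in>(UNIV :: 'v set). 0 + 0)"
      by (intro tendsto_sum tendsto_add Re[OF \<delta>] Im[OF \<delta>])
    show ?thesis
      by (rule tendsto_sandwich[OF _ _ tendsto_const lim[simplified]])
         (intro always_eventually allI measure_nonneg le)+
  qed
  then show ?thesis
    unfolding tendsto_in_prob_def
    by (intro conjI allI impI borel_measurable_complex_vec meas borel_measurable_const)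
qed

section \<open>The estimator as an average of bounded variables\<close>

lemma norm_empirical_char_le_1: "norm (empirical_char Z n \<omega> s) \<le> 1"
\<comment> \<open>For \<open>n = 0\<close> the division by zero makes \<open>empirical_char\<close>
  vanish.\<close>
proof (cases "n = 0")
  case False
  have "norm (\<Sum>j=1..n. iexp (s \<bullet> Z j \<omega>)) \<le> (\<Sum>j=1..n. 1)"
    by (rule sum_norm_le) simp
  then show ?thesis using False by (simp add: empirical_char_def norm_divide)
qed (simp add: empirical_char_def)

lemma norm_fourier_le: "norm (fourier b z) \<le> (LINT s|lborel. norm (b s))"
proof -
  have "norm (fourier b z) \<le> (LINT s|lborel. norm (b s * iexp (s \<bullet> z)))"
    unfolding fourier_def by (rule integral_norm_bound)
  then show ?thesis by (simp add: norm_mult)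
qed

lemma fourier_measurable:
  assumes [measurable]: "b \<in> borel_measurable borel"
  shows "fourier b \<in> borel_measurable borel"
  unfolding fourier_def[abs_def] by measurable

lemma deconv_estimator_eq_average:
  assumes "integrable lborel (\<lambda>s. inverse (\<phi> s) * inv_fourier \<psi> s)"
  shows "deconv_estimator \<phi> Z n \<omega> \<psi>
    = (\<Sum>j=1..n. fourier (\<lambda>s. inverse (\<phi> s) * inv_fourier \<psi> s) (Z j \<omega>)) / of_nat n"
proof -
  let ?b = "\<lambda>s. inverse (\<phi> s) * inv_fourier \<psi> s"
  have "inverse (\<phi> s) * empirical_char Z n \<omega> s * inv_fourier \<psi> s = (\<Sum>j=1..n. ?b s * iexp (s \<bullet> Z j \<omega>)) / of_nat n" for s
    by (simp add: empirical_char_def sum_distrib_left[symmetric])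
  then have "deconv_estimator \<phi> Z n \<omega> \<psi> = (LINT s|lborel. (\<Sum>j=1..n. ?b s * iexp (s \<bullet> Z j \<omega>)) / of_nat n)"
    by (simp only: deconv_estimator_def Ft_inv_def regular_def)
  also have "\<dots> = (LINT s|lborel. (\<Sum>j=1..n. ?b s * iexp (s \<bullet> Z j \<omega>))) / of_nat n"
    by (rule integral_divide_zero)
  also have "(LINT s|lborel. (\<Sum>j=1..n. ?b s * iexp (s \<bullet> Z j \<omega>))) = (\<Sum>j=1..n. LINT s|lborel. ?b s * iexp (s \<bullet> Z j \<omega>))"
    by (intro Bochner_Integration.integral_sum integrable_mult_iexp assms) simp
  finally show ?thesis by (simp add: fourier_def)
qed

theorem mainTheorem7:
  fixes M :: "'a measure"
    and g f w :: "'d::finite functional"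
    and \<phi> :: "real ^ 'd \<Rightarrow> complex"
    and m :: "'d \<Rightarrow> nat"
    and Z :: "nat \<Rightarrow> 'a \<Rightarrow> real ^ 'd"
    and \<psi> :: "'v::finite \<Rightarrow> 'd test_fun"
  assumes "prob_space M"
    and "generalized_density g" "generalized_density f" "generalized_density w"
    and "gen_convolution_eq g f w"
    and "represented_by (Ft f) \<phi>"
    and "AE t in lborel. \<phi> t \<noteq> 0"
    and "integrable lborel
      (\<lambda>t. (\<Prod>i\<in>UNIV. inverse ((1 + (t $ i)\<^sup>2) ^ m i)) * norm (inverse (\<phi> t)))"
    and "prob_space.indep_vars M (\<lambda>_. borel) Z {1..}"
    and "\<And>j. j \<ge> 1 \<Longrightarrow> has_gen_density (distr M borel (Z j)) w"
    and "\<And>k. \<psi> k \<in> Schwartz"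
  shows "(\<forall>n. \<forall>\<omega>\<in>space M. deconv_estimator \<phi> Z n \<omega> \<in> tempered) \<and>
    tendsto_in_prob M
      (\<lambda>n \<omega>. (\<chi> k. deconv_estimator \<phi> Z n \<omega> (\<psi> k) - g (\<psi> k)) :: complex ^ 'v) (\<lambda>_. 0)"
proof
  interpret prob_space M by fact
  have [measurable]: "\<phi> \<in> borel_measurable borel"
    using assms(6) by (simp add: represented_by_def)
  have w_int: "integrable lborel (\<lambda>t. weight m t * norm (inverse (\<phi> t)))"
    using assms(8) by (simp add: weight_def)
  obtain G F where G: "has_gen_density G g" and F: "has_gen_density F f" and W: "has_gen_density (G \<star> F) w"
    using assms(5) by (auto simp: gen_convolution_eq_def)
  have probs: "prob_space G" "prob_space F" "sets G = sets borel" "sets F = sets borel"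
    using F G by (auto simp: has_gen_density_def)
  have Z [measurable]: "Z j \<in> borel_measurable M" if "1 \<le> j" for j
    using assms(9) that by (auto simp: indep_vars_def)

  show "\<forall>n. \<forall>\<omega>\<in>space M. deconv_estimator \<phi> Z n \<omega> \<in> tempered"
    unfolding deconv_estimator_def
  proof (intro allI ballI Ft_inv_regular_tempered)
    fix n \<omega>
    show meas: "(\<lambda>s. inverse (\<phi> s) * empirical_char Z n \<omega> s) \<in> borel_measurable borel"
      unfolding empirical_char_def by measurable
    \<comment> \<open>The empirical characteristic function has modulus at most 1, so the product
      inherits the growth condition on \<open>inverse \<phi>\<close>.\<close>
    show "integrable lborel (\<lambda>t. weight m t * norm (inverse (\<phi> t) * empirical_char Z n \<omega> t))"
    proof (rule Bochner_Integration.integrable_bound[OF w_int])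
      show "(\<lambda>t. weight m t * norm (inverse (\<phi> t) * empirical_char Z n \<omega> t)) \<in> borel_measurable lborel"
        using meas by measurable
      show "AE t in lborel. norm (weight m t * norm (inverse (\<phi> t) * empirical_char Z n \<omega> t))
          \<le> norm (weight m t * norm (inverse (\<phi> t)))"
        unfolding norm_mult real_norm_def abs_mult abs_norm_cancel
        by (intro AE_I2 mult_left_mono mult_left_le norm_empirical_char_le_1) auto
    qed
  qed

  define b where "b k s = inverse (\<phi> s) * inv_fourier (\<psi> k) s" for k s
  define h where "h k = fourier (b k)" for k
  have b_int: "integrable lborel (b k)" for k
    unfolding b_def[abs_def] by (rule integrable_mult_inv_fourier[OF _ w_int assms(11)]) measurable
  have [measurable]: "h k \<in> borel_measurable borel" for k
    unfolding h_def by (rule fourier_measurable) (use b_int[of k] in simp)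
  define B where "B k = (LINT s|lborel. norm (b k s))" for k
  have h_bound: "norm (h k z) \<le> B k" for k z
    unfolding h_def B_def by (rule norm_fourier_le)
  have est: "deconv_estimator \<phi> Z n \<omega> (\<psi> k) = (\<Sum>j=1..n. h k (Z j \<omega>)) / of_nat n" for n \<omega> k
    unfolding h_def b_def by (rule deconv_estimator_eq_average) (use b_int[of k] in \<open>simp add: b_def[abs_def]\<close>)
  have h_int: "integrable M (\<lambda>\<omega>. h k (Z j \<omega>))" if "1 \<le> j" for j k
    by (rule integrable_const_bound[of _ "B k"])
       (use measurable_compose[OF Z[OF that], of "h k" borel] h_bound in simp_all)
  have h_mean: "(LINT \<omega>|M. h k (Z j \<omega>)) = g (\<psi> k)" if j: "1 \<le> j" for j k
  proof -
    have D: "has_gen_density (distr M borel (Z j)) w" by (rule assms(10)[OF j])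
    have "(LINT \<omega>|M. h k (Z j \<omega>)) = (LINT z|distr M borel (Z j). h k z)"
      by (subst integral_distr) (use Z[OF j] in auto)
    also have "\<dots> = (LINT s|lborel. b k s * cf (distr M borel (Z j)) s)"
      unfolding h_def using D by (intro integral_fourier_eq b_int) (auto simp: has_gen_density_def)
    also have "\<dots> = (LINT s|lborel. inv_fourier (\<psi> k) s * cf G s)"
    proof (rule integral_cong_AE)
      have [measurable]: "cf (distr M borel (Z j)) \<in> borel_measurable borel" "cf G \<in> borel_measurable borel"
        using cf_measurable[of "distr M borel (Z j)"] cf_measurable[of G] D G
        by (simp_all add: has_gen_density_def)
      have [measurable]: "b k \<in> borel_measurable borel" "inv_fourier (\<psi> k) \<in> borel_measurable borel"
        using b_int[of k] inv_fourier_Schwartz_integrable[OF assms(11)[of k]] by simp_all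
      show "(\<lambda>s. b k s * cf (distr M borel (Z j)) s) \<in> borel_measurable lborel"
        "(\<lambda>s. inv_fourier (\<psi> k) s * cf G s) \<in> borel_measurable lborel" by measurable
      \<comment> \<open>Almost everywhere the law of \<open>Z j\<close> has characteristic function
        \<open>cf G s * cf F s\<close>, \<open>\<phi> s\<close> equals \<open>cf F s\<close>, and it
        is nonzero; so \<open>inverse (\<phi> s)\<close> cancels the error factor.\<close>
      show "AE s in lborel. b k s * cf (distr M borel (Z j)) s = inv_fourier (\<psi> k) s * cf G s"
        using cf_unique_AE[OF D W] represented_by_cf_AE[OF F assms(6)] assms(7)
        by eventually_elim (simp add: b_def cf_convolution[OF probs])
    qed
    also have "\<dots> = (LINT z|G. fourier (inv_fourier (\<psi> k)) z)"
      by (intro integral_fourier_eq[symmetric] probs inv_fourier_Schwartz_integrable assms)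
    also have "\<dots> = g (\<psi> k)"
      by (simp add: fourier_inv_fourier assms(11) has_gen_density_integral[OF G])
    finally show ?thesis .
  qed
  \<comment> \<open>The functional \<open>p\<close> stands for \<open>Re\<close> and
    \<open>Im\<close>, so that the real weak law is applied once for both.\<close>
  have lim: "(\<lambda>n. measure M {\<omega> \<in> space M. \<epsilon> \<le> \<bar>p (deconv_estimator \<phi> Z n \<omega> (\<psi> k) - g (\<psi> k))\<bar>}) \<longlonglongrightarrow> 0"
    if p: "bounded_linear p" "\<And>z. \<bar>p z\<bar> \<le> norm z" and \<epsilon>: "0 < \<epsilon>" for p :: "complex \<Rightarrow> real" and \<epsilon> k
  proof -
    interpret p: bounded_linear p by (rule p(1))
    have [measurable]: "p \<in> borel_measurable borel"
      by (intro borel_measurable_continuous_onI p.continuous_on continuous_on_id)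
    have "p (deconv_estimator \<phi> Z n \<omega> (\<psi> k) - g (\<psi> k)) = (\<Sum>j=1..n. p (h k (Z j \<omega>))) / real n - p (g (\<psi> k))" for n \<omega>
    proof -
      \<comment> \<open>Division by \<open>n\<close> is rewritten as a real scaling because
        \<open>p\<close> is only real-linear.\<close>
      have "z / of_nat n = inverse (real n) *\<^sub>R z" for z :: complex
        by (simp add: scaleR_conv_of_real divide_inverse mult.commute)
      then show ?thesis
        unfolding est p.diff by (simp only: p.scaleR p.sum) (simp add: divide_inverse mult.commute)
    qed
    then show ?thesis
    proof (simp only:, intro weak_law_bounded[OF assms(1)] \<epsilon>)
      show "indep_vars (\<lambda>_. borel) (\<lambda>j \<omega>. p (h k (Z j \<omega>))) {1..}"
        by (rule indep_vars_compose2[OF assms(9)]) measurable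
      show "\<bar>p (h k (Z j \<omega>))\<bar> \<le> B k" for j \<omega>
        using p(2) h_bound order_trans by blast
      show "(LINT \<omega>|M. p (h k (Z j \<omega>))) = p (g (\<psi> k))" if "1 \<le> j" for j
        using integral_bounded_linear[OF p(1) h_int[OF that, of k]] h_mean[OF that] by simp
    qed
  qed
  show "tendsto_in_prob M
      (\<lambda>n \<omega>. (\<chi> k. deconv_estimator \<phi> Z n \<omega> (\<psi> k) - g (\<psi> k)) :: complex ^ 'v) (\<lambda>_. 0)"
  proof (rule tendsto_in_prob_vec[OF assms(1)])
    show "(\<lambda>\<omega>. deconv_estimator \<phi> Z n \<omega> (\<psi> k) - g (\<psi> k)) \<in> borel_measurable M" for n k
    proof -
      \<comment> \<open>The averages start at \<open>j = 1\<close>, where measurability of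
        \<open>Z j\<close> is available.\<close>
      have "(\<lambda>\<omega>. h k (Z j \<omega>)) \<in> borel_measurable M" if "j \<in> {1..n}" for j
        using that by (intro measurable_compose[OF Z, of j "h k"]) auto
      then show ?thesis
        unfolding est by (intro borel_measurable_diff borel_measurable_divide borel_measurable_sum
            borel_measurable_const)
    qed
  qed (rule lim[OF bounded_linear_Re abs_Re_le_cmod] lim[OF bounded_linear_Im abs_Im_le_cmod], assumption)+
qed

end
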